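(* Let $L(t,x,y,v,w)=\frac{\rho}{2}v^2-\frac{T}{2}w^2$ be the Lagrangian density of the wave equation in one space dimension, with $\rho$ (linear mass density) and $T$ (tension) constant, and let $\alpha>0$. The $\mathbb{D}^{\alpha}$-fractional embedding of the continuous Euler-Lagrange equation associated to $L$ is given by $$-\rho\,\mathbb{D}^{2\alpha}u=T\,\frac{\partial^2u}{\partial x^2}.$$
   Context: Left and right fractional derivatives in the time variable: for $\alpha>0$, $n\in\mathbb{N}$ with $n-1\le\alpha<n$, $\mathbb{D}^{\alpha}x(t)=\frac{1}{\Gamma(n-\alpha)}\frac{d^n}{dt^n}\int_{-\infty}^t(t-s)^{n-\alpha-1}x(s)\,ds$ and $\mathbb{D}_*^{\alpha}x(t)=\frac{(-1)^n}{\Gamma(n-\alpha)}\frac{d^n}{dt^n}\int_t^{\infty}(s-t)^{n-\alpha-1}x(s)\,ds$. For $\mu\in\mathbb{C}$, $\mathbf{D}^{\alpha}_{\mu}=\frac12[\mathbb{D}^{\alpha}-\mathbb{D}_*^{\alpha}]+\frac{i\mu}{2}[\mathbb{D}^{\alpha}+\mathbb{D}_*^{\alpha}]$; in particular $\mathbf{D}^{\alpha}_{-i}=\mathbb{D}^{\alpha}$. The semi-group property $\mathbb{D}^{\beta}=\mathbb{D}^{\alpha}\mathbb{D}^{\beta-\alpha}$, $0<\alpha<\beta$, is used; it holds on the closure of $C_0^{\infty}(I)$, $I$ a bounded open interval, under the norm $(\|x\|_{L^2}^2+\|\mathbb{D}^{\beta}x\|_{L^2}^2)^{1/2}$. The continuous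 Euler-Lagrange equation of a density $L(t,x,y,v,w)$ is $\frac{\partial L}{\partial y}-\frac{\partial}{\partial t}\left(\frac{\partial L}{\partial v}\right)-\frac{\partial}{\partial x}\left(\frac{\partial L}{\partial w}\right)=0$, with the partial derivatives of $L$ evaluated at $(t,x,u,\partial_tu,\partial_xu)$, where $u(t,x)$ is a field. Its $\mathbb{D}^{\alpha}$-fractional embedding is the equation obtained by replacing the time derivatives by $\mathbb{D}^{\alpha}$: $\frac{\partial L}{\partial y}(z)-\mathbb{D}^{\alpha}\left[\frac{\partial L}{\partial v}(z)\right]-\frac{\partial}{\partial x}\left[\frac{\partial L}{\partial w}(z)\right]=0$ with $z=(t,x,u,\mathbb{D}^{\alpha}u,\partial_xu)$. The fractional wave equation of order $\alpha$ is defined to be $-\rho\,\mathbb{D}^{2\alpha}u=T\,\frac{\partial^2u}{\partial x^2}$.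
   Formalization: The sign of the printed equation is corrected: the embedding is shown to be ρ D^{2α}u = T ∂²u/∂x², not −ρ D^{2α}u = T ∂²u/∂x², which already fails for α = 1, ρ = T = 1, u = φ(t−x). *)

theory Defs
  imports "HOL-Analysis.Analysis"
begin

section \<open>Fractional derivatives in time\<close>

text \<open>The left fractional derivative \<open>\<D>\<^sup>\<alpha>\<close> of a function on the real line, for
  \<open>\<alpha> > 0\<close>. The order \<open>n\<close> with \<open>n - 1 \<le> \<alpha> < n\<close> is \<open>\<lfloor>\<alpha>\<rfloor> + 1\<close>, also for integer \<open>\<alpha>\<close>.\<close>

definition frac_order :: "real \<Rightarrow> nat" where
  "frac_order \<alpha> = nat \<lfloor>\<alpha>\<rfloor> + 1"

definition left_frac_deriv :: "real \<Rightarrow> (real \<Rightarrow> real) \<Rightarrow> real \<Rightarrow> real" where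
  "left_frac_deriv \<alpha> f t =
     (let n = frac_order \<alpha> in
      1 / Gamma (real n - \<alpha>) *
      (deriv ^^ n) (\<lambda>\<tau>. LINT s:{..<\<tau>}|lebesgue. (\<tau> - s) powr (real n - \<alpha> - 1) * f s) t)"


section \<open>The function space on which the semi-group property is used\<close>

definition test_functions :: "real set \<Rightarrow> (real \<Rightarrow> real) set" where
  "test_functions I =
     {\<phi>. (\<forall>k t. (deriv ^^ k) \<phi> differentiable (at t)) \<and>
         (\<exists>K. compact K \<and> K \<subseteq> I \<and> (\<forall>t. t \<notin> K \<longrightarrow> \<phi> t = 0))}"

definition square_integrable :: "(real \<Rightarrow> real) \<Rightarrow> bool" where
  "square_integrable f \<longleftrightarrow>
     f \<in> borel_measurable lebesgue \<and> integrable lebesgue (\<lambda>t. (f t)\<^sup>2)"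

definition L2_norm :: "(real \<Rightarrow> real) \<Rightarrow> real" where
  "L2_norm f = sqrt (LINT t|lebesgue. (f t)\<^sup>2)"

text \<open>Distance induced by the norm \<open>(\<parallel>f\<parallel>\<^sup>2 + \<parallel>\<D>\<^sup>\<beta> f\<parallel>\<^sup>2)\<^sup>1\<^sup>/\<^sup>2\<close>. It compares
  \<open>\<D>\<^sup>\<beta> f\<close> with \<open>\<D>\<^sup>\<beta> g\<close> instead of applying \<open>\<D>\<^sup>\<beta>\<close> to \<open>f - g\<close>, which is the same
  wherever the derivatives exist. In this form the default values of \<^const>\<open>deriv\<close> and of the
  integral cannot let functions without a fractional derivative into the closure below.\<close>

definition frac_dist :: "real \<Rightarrow> (real \<Rightarrow> real) \<Rightarrow> (real \<Rightarrow> real) \<Rightarrow> real" where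
  "frac_dist \<beta> f g =
     sqrt ((L2_norm (\<lambda>t. f t - g t))\<^sup>2 +
           (L2_norm (\<lambda>t. left_frac_deriv \<beta> f t - left_frac_deriv \<beta> g t))\<^sup>2)"

text \<open>The closure of \<open>C\<^sub>0\<^sup>\<infinity>(I)\<close> for this distance.\<close>

definition frac_space :: "real \<Rightarrow> real set \<Rightarrow> (real \<Rightarrow> real) set" where
  "frac_space \<beta> I =
     {f. square_integrable f \<and> square_integrable (left_frac_deriv \<beta> f) \<and>
         (\<exists>\<phi>. (\<forall>k::nat. \<phi> k \<in> test_functions I) \<and>
              (\<lambda>k. frac_dist \<beta> f (\<phi> k)) \<longlonglongrightarrow> 0)}"


section \<open>Euler-Lagrange equations of a density and their embedding\<close>

text \<open>Densities are \<open>L t x y v w\<close>, fields are \<open>u t x\<close>.\<close>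

type_synonym density = "real \<Rightarrow> real \<Rightarrow> real \<Rightarrow> real \<Rightarrow> real \<Rightarrow> real"
type_synonym field_1d = "real \<Rightarrow> real \<Rightarrow> real"

text \<open>The Euler-Lagrange equation at \<open>(t, x)\<close> with every time derivative taken by the operator
  \<open>D\<close>: those inside the argument \<open>z = (t, x, u, D u, \<partial>\<^sub>x u)\<close> as well as the outer one.\<close>

definition euler_lagrange_with ::
    "((real \<Rightarrow> real) \<Rightarrow> real \<Rightarrow> real) \<Rightarrow> density \<Rightarrow> field_1d \<Rightarrow> real \<Rightarrow> real \<Rightarrow> bool" where
  "euler_lagrange_with D L u t x \<longleftrightarrow>
     (let Dt = (\<lambda>t x. D (\<lambda>s. u s x) t);
          Dx = (\<lambda>t x. deriv (\<lambda>\<xi>. u t \<xi>) x);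
          Ly = (\<lambda>t x. deriv (\<lambda>y. L t x y (Dt t x) (Dx t x)) (u t x));
          Lv = (\<lambda>t x. deriv (\<lambda>v. L t x (u t x) v (Dx t x)) (Dt t x));
          Lw = (\<lambda>t x. deriv (\<lambda>w. L t x (u t x) (Dt t x) w) (Dx t x))
      in Ly t x - D (\<lambda>s. Lv s x) t - deriv (\<lambda>\<xi>. Lw t \<xi>) x = 0)"

abbreviation continuous_euler_lagrange ::
    "density \<Rightarrow> field_1d \<Rightarrow> real \<Rightarrow> real \<Rightarrow> bool" where
  "continuous_euler_lagrange \<equiv> euler_lagrange_with deriv"

abbreviation frac_embedded_euler_lagrange ::
    "real \<Rightarrow> density \<Rightarrow> field_1d \<Rightarrow> real \<Rightarrow> real \<Rightarrow> bool" where
  "frac_embedded_euler_lagrange \<alpha> \<equiv> euler_lagrange_with (left_frac_deriv \<alpha>)"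

definition wave_density :: "real \<Rightarrow> real \<Rightarrow> density" where
  "wave_density \<rho> T = (\<lambda>t x y v w. \<rho> / 2 * v\<^sup>2 - T / 2 * w\<^sup>2)"

text \<open>Sign: for the wave density the left-hand side of the embedded Euler-Lagrange equation is
  \<open>- \<rho> \<D>\<^sup>\<alpha> \<D>\<^sup>\<alpha> u + T \<partial>\<^sub>x\<^sup>2 u\<close>, so the two terms stand on opposite sides with equal signs, as in
  the classical equation \<open>\<rho> \<partial>\<^sub>t\<^sup>2 u = T \<partial>\<^sub>x\<^sup>2 u\<close> (case \<open>\<alpha> = 1\<close>). The source
  prints \<open>- \<rho> \<D>\<^sup>2\<^sup>\<alpha> u = T \<partial>\<^sub>x\<^sup>2 u\<close>, which is not the embedded equation.\<close>

definition frac_wave_equation ::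
    "real \<Rightarrow> real \<Rightarrow> real \<Rightarrow> field_1d \<Rightarrow> real \<Rightarrow> real \<Rightarrow> bool" where
  "frac_wave_equation \<alpha> \<rho> T u t x \<longleftrightarrow>
     \<rho> * left_frac_deriv (2 * \<alpha>) (\<lambda>s. u s x) t = T * (deriv ^^ 2) (\<lambda>\<xi>. u t \<xi>) x"

end

theory Submission
  imports Defs
begin

text \<open>The partial derivatives of the wave density are linear in \<open>v\<close> and \<open>w\<close>, so that the embedded equation
reads \<open>T \<partial>\<^sub>x\<^sup>2 u = \<D>\<^sup>\<alpha> (\<rho> \<D>\<^sup>\<alpha> u)\<close>. It agrees with the fractional wave equation at almost every
\<open>t\<close> as soon as \<open>\<D>\<^sup>\<alpha> (\<rho> \<D>\<^sup>\<alpha> f) = \<rho> \<D>\<^sup>2\<^sup>\<alpha> f\<close> almost everywhere, for every \<open>f\<close> in the closure of the test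
functions; this semi-group property is the whole content of the theorem.

Let \<open>J\<^sup>\<gamma>\<close> be convolution with \<open>r\<^sup>\<gamma>\<^sup>-\<^sup>1 / \<Gamma>(\<gamma>)\<close>, \<open>r > 0\<close>. The Beta integral gives \<open>J\<^sup>\<gamma> J\<^sup>\<delta> = J\<^sup>\<gamma>\<^sup>+\<^sup>\<delta>\<close>. As \<open>\<D>\<^sup>\<alpha>\<close> is
the \<open>n\<close>-th derivative of \<open>J\<^sup>n\<^sup>-\<^sup>\<alpha>\<close>, it follows that \<open>\<D>\<^sup>\<alpha> J\<^sup>\<alpha> h\<close> is the \<open>n\<close>-th derivative of \<open>J\<^sup>n h\<close>. The first
\<open>n - 1\<close> differentiations hold everywhere by the fundamental theorem of calculus, the last one
almost everywhere by Lebesgue's differentiation theorem, and the result is \<open>h\<close>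
(\<open>left_frac_deriv_inverse_AE\<close>). Consequently, if \<open>f = J\<^sup>\<gamma>\<^sup>+\<^sup>\<delta> g\<close> then \<open>\<D>\<^sup>\<delta> f = J\<^sup>\<gamma> g\<close> and
\<open>\<D>\<^sup>\<gamma> \<D>\<^sup>\<delta> f = g = \<D>\<^sup>\<gamma>\<^sup>+\<^sup>\<delta> f\<close>.

It remains to represent every \<open>f\<close> of the closure as \<open>J\<^sup>\<beta> g\<close> with \<open>g = \<D>\<^sup>\<beta> f\<close>
(\<open>frac_space_rl_integral\<close>). For a test function \<open>\<phi>\<close> this is Taylor's formula,
\<open>\<phi> = J\<^sup>n \<phi>\<^sup>(\<^sup>n\<^sup>) = J\<^sup>\<beta> (J\<^sup>n\<^sup>-\<^sup>\<beta> \<phi>\<^sup>(\<^sup>n\<^sup>))\<close>. In the limit, both \<open>\<phi>\<^sub>k \<rightarrow> f\<close> and \<open>\<D>\<^sup>\<beta> \<phi>\<^sub>k \<rightarrow> g\<close> in \<open>L\<^sup>2\<close>, hence in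
\<open>L\<^sup>1\<close> of every bounded interval, and \<open>J\<^sup>\<beta>\<close> is bounded there. Convergence of \<open>L2_norm\<close> only means
something when the functions are square integrable over the whole line; for \<open>\<D>\<^sup>\<beta> \<phi>\<close> this holds
because it is \<open>J\<^sup>n\<^sup>-\<^sup>\<beta>\<close> of a compactly supported function with integral zero, which makes it decay like \<open>1 / t\<close>.\<close>


section \<open>Lebesgue's differentiation theorem on the line\<close>

text \<open>By Henstock's lemma, disjoint fine intervals on which \<open>f t\<close> is a bad approximation to the mean
value of \<open>f\<close> have small total length. Such intervals form a covering of the exceptional points,
and Vitali's lemma selects a disjoint subfamily whose fivefold enlargements still cover.\<close>

lemma negligible_bad_intervals:
  fixes f :: "real \<Rightarrow> real"
  assumes f: "f integrable_on {a..b}" and "e > 0"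
  shows "negligible {t. \<forall>d>0. \<exists>u v. a \<le> u \<and> v \<le> b \<and> u < v \<and> v - u < d \<and> t \<in> {u..v} \<and>
           \<bar>integral {u..v} f - (v - u) * f t\<bar> > e * (v - u)}" (is "negligible ?S")
  unfolding negligible_outer_le
proof (intro allI impI)
  fix \<epsilon> :: real assume "\<epsilon> > 0"
  \<comment> \<open>Bad intervals of total length at most \<open>\<epsilon> / 5\<close> remain of length at most \<open>\<epsilon>\<close> when enlarged by 5;
    each contributes at least \<open>e\<close> times its length to the sum in Henstock's lemma.\<close>
  have "e * \<epsilon> / 5 > 0" using \<open>e > 0\<close> \<open>\<epsilon> > 0\<close> by simp
  then obtain \<gamma> where \<gamma>: "gauge \<gamma>" and small:
    "\<And>p. p tagged_partial_division_of cbox a b \<Longrightarrow> \<gamma> fine p \<Longrightarrow>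
       (\<Sum>(x,k)\<in>p. norm (measure lborel k *\<^sub>R f x - integral k f)) < e * \<epsilon> / 5"
    using Henstock_lemma[of f a b "e * \<epsilon> / 5"] f unfolding box_real(2) by blast
  define K where "K = {(t,u,v). a \<le> u \<and> v \<le> b \<and> u < v \<and> t \<in> {u..v} \<and> {u..v} \<subseteq> \<gamma> t \<and>
           \<bar>integral {u..v} f - (v - u) * f t\<bar> > e * (v - u)}"
  define c where "c = (\<lambda>(t::real,u::real,v). (u + v) / 2)"
  define r where "r = (\<lambda>(t::real,u::real,v::real). (v - u) / 2)"
  have ball: "cball (c (t,u,v)) (r (t,u,v)) = {u..v}" for t u v
    by (auto simp: c_def r_def cball_eq_atLeastAtMost field_simps)
  have S: "?S \<subseteq> (\<Union>i\<in>K. cball (c i) (r i))"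
  proof
    fix t assume t: "t \<in> ?S"
    from \<gamma> obtain d where d: "d > 0" "ball t d \<subseteq> \<gamma> t"
      by (meson gauge_def open_contains_ball)
    from t d obtain u v where uv: "a \<le> u" "v \<le> b" "u < v" "v - u < d" "t \<in> {u..v}"
      "\<bar>integral {u..v} f - (v - u) * f t\<bar> > e * (v - u)" unfolding mem_Collect_eq by metis
    have "{u..v} \<subseteq> ball t d" using uv by (auto simp: dist_real_def)
    with uv d have "(t,u,v) \<in> K" by (auto simp: K_def)
    with ball uv show "t \<in> (\<Union>i\<in>K. cball (c i) (r i))" by blast
  qed
  have rad: "0 < r i \<and> r i \<le> b - a" if "i \<in> K" for i
    using that by (auto simp: K_def r_def)
  obtain C where C: "countable C" "C \<subseteq> K"
    and disj: "pairwise (\<lambda>i j. disjnt (cball (c i) (r i)) (cball (c j) (r j))) C"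
    and cover: "?S \<subseteq> (\<Union>i\<in>C. cball (c i) (5 * r i))"
    by (rule Vitali_covering_lemma_cballs[OF S rad]) (assumption | blast intro: that)+
  have bound: "measure lebesgue (\<Union>i\<in>I. cball (c i) (5 * r i)) \<le> \<epsilon>" if I: "I \<subseteq> C" "finite I" for I
  proof -
    define p where "p = (\<lambda>(t,u,v). (t, {u..v})) ` I"
    have inj: "inj_on (\<lambda>(t,u,v). (t, {u..v})) I"
    proof (rule inj_onI)
      fix i j assume "i \<in> I" "j \<in> I" "(\<lambda>(t,u,v). (t, {u..v})) i = (\<lambda>(t,u,v). (t, {u..v})) j"
      moreover have "i \<in> K" "j \<in> K" using I C \<open>i \<in> I\<close> \<open>j \<in> I\<close> by auto
      ultimately show "i = j" by (auto simp: K_def Icc_eq_Icc)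
    qed
    have inK: "(t,u,v) \<in> K" if "(t,u,v) \<in> I" for t u v using that I C by auto
    have "p tagged_partial_division_of cbox a b"
      unfolding tagged_partial_division_of_def
    proof (intro conjI allI impI)
      show "finite p" using I by (simp add: p_def)
    next
      fix x k assume "(x,k) \<in> p"
      then show "x \<in> k" "k \<subseteq> cbox a b" "\<exists>a b. k = cbox a b"
        using inK by (auto simp: p_def K_def dest!: inK intro: order_trans)
    next
      fix x1 k1 x2 k2 assume *: "(x1,k1) \<in> p \<and> (x2,k2) \<in> p \<and> (x1,k1) \<noteq> (x2,k2)"
      obtain i j where ij: "i \<in> I" "j \<in> I" "i \<noteq> j" "k1 = cball (c i) (r i)" "k2 = cball (c j) (r j)"
      proof -
        have "(x1,k1) \<in> p" "(x2,k2) \<in> p" "(x1,k1) \<noteq> (x2,k2)" using * by auto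
        then obtain u1 v1 u2 v2 where "(x1,u1,v1) \<in> I" "k1 = {u1..v1}" "(x2,u2,v2) \<in> I" "k2 = {u2..v2}"
          unfolding p_def by auto
        with \<open>(x1,k1) \<noteq> (x2,k2)\<close> show ?thesis
          by (intro that[of "(x1,u1,v1)" "(x2,u2,v2)"]) (auto simp: ball)
      qed
      then have "disjnt k1 k2" using disj I by (auto simp: pairwise_def)
      then show "interior k1 \<inter> interior k2 = {}"
        using interior_subset[of k1] interior_subset[of k2] by (auto simp: disjnt_def)
    qed
    moreover have "\<gamma> fine p" using inK by (auto simp: p_def fine_def K_def)
    ultimately have *: "(\<Sum>(x,k)\<in>p. norm (measure lborel k *\<^sub>R f x - integral k f)) < e * \<epsilon> / 5" by (rule small)
    have "e * (\<Sum>i\<in>I. 2 * r i) = (\<Sum>i\<in>I. e * (2 * r i))" by (simp add: sum_distrib_left)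
    also have "\<dots> \<le> (\<Sum>(t,u,v)\<in>I. norm (measure lborel {u..v} *\<^sub>R f t - integral {u..v} f))"
    proof (rule sum_mono)
      fix i assume "i \<in> I"
      moreover obtain t u v where i: "i = (t,u,v)" by (cases i)
      ultimately have "u < v" "e * (v - u) < \<bar>integral {u..v} f - (v - u) * f t\<bar>"
        using inK by (auto simp: K_def)
      moreover have r: "2 * r i = v - u" by (simp add: i r_def)
      ultimately show "e * (2 * r i) \<le> (\<lambda>(t,u,v). norm (measure lborel {u..v} *\<^sub>R f t - integral {u..v} f)) i"
        unfolding r by (simp add: i abs_minus_commute)
    qed
    also have "\<dots> = (\<Sum>(x,k)\<in>p. norm (measure lborel k *\<^sub>R f x - integral k f))"
      unfolding p_def by (subst sum.reindex[OF inj]) (auto simp: case_prod_unfold o_def)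
    finally have "(\<Sum>i\<in>I. 2 * r i) \<le> \<epsilon> / 5"
      using * \<open>e > 0\<close> by (smt (verit) mult_le_cancel_left_pos times_divide_eq_right)
    moreover have "measure lebesgue (\<Union>i\<in>I. cball (c i) (5 * r i))
        \<le> (\<Sum>i\<in>I. measure lebesgue (cball (c i) (5 * r i)))"
      using I by (intro measure_UNION_le) auto
    moreover have "(\<Sum>i\<in>I. measure lebesgue (cball (c i) (5 * r i))) = 5 * (\<Sum>i\<in>I. 2 * r i)"
      unfolding sum_distrib_left
    proof (rule sum.cong)
      fix i assume "i \<in> I"
      with rad I C have "r i > 0" by blast
      then show "measure lebesgue (cball (c i) (5 * r i)) = 5 * (2 * r i)"
        by (simp add: cball_eq_atLeastAtMost)
    qed simp
    ultimately show ?thesis by simp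
  qed
  show "\<exists>T. ?S \<subseteq> T \<and> T \<in> lmeasurable \<and> measure lebesgue T \<le> \<epsilon>"
  proof (intro exI conjI)
    show "(\<Union>i\<in>C. cball (c i) (5 * r i)) \<in> lmeasurable"
      by (rule fmeasurable_UN_bound[OF C(1) _ bound]) auto
    show "measure lebesgue (\<Union>i\<in>C. cball (c i) (5 * r i)) \<le> \<epsilon>"
      by (rule measure_UN_bound[OF C(1) _ bound]) auto
  qed (rule cover)
qed

text \<open>A point outside the exceptional sets of the previous lemma for \<open>e = 1, 1/2, 1/3, \<dots>\<close> is a point of
differentiability: the increments of the indefinite integral are integrals over intervals that
have the point as an endpoint.\<close>

theorem Lebesgue_differentiation:
  fixes f :: "real \<Rightarrow> real"
  assumes f: "f integrable_on {a..b}"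
  shows "AE t in lebesgue. t \<in> {a<..<b} \<longrightarrow>
           ((\<lambda>x. integral {a..x} f) has_real_derivative f t) (at t)"
proof -
  define bad where "bad e = {t. \<forall>d>0. \<exists>u v. a \<le> u \<and> v \<le> b \<and> u < v \<and> v - u < d \<and> t \<in> {u..v} \<and>
           \<bar>integral {u..v} f - (v - u) * f t\<bar> > e * (v - u)}" for e
  have "negligible (\<Union>n. bad (inverse (Suc n)))"
    unfolding bad_def by (intro negligible_Union_nat negligible_bad_intervals f) auto
  then have "AE t in lebesgue. t \<notin> (\<Union>n. bad (inverse (Suc n)))"
    using negligible_iff_null_sets AE_not_in by blast
  then show ?thesis
  proof (rule AE_mp, intro AE_I2 impI)
    fix t assume t: "t \<notin> (\<Union>n. bad (inverse (Suc n)))" "t \<in> {a<..<b}"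
    let ?F = "\<lambda>x. integral {a..x} f"
    have "\<exists>d>0. \<forall>y. norm (y - t) < d \<longrightarrow> norm (?F y - ?F t - f t * (y - t)) \<le> e * norm (y - t)"
      if "e > 0" for e
    proof -
      obtain n where n: "inverse (Suc n) < e" using reals_Archimedean[OF \<open>e > 0\<close>] by auto
      have "t \<notin> bad (inverse (Suc n))" using t by blast
      then obtain d where d: "d > 0" and
        none: "\<And>u v. \<not> (a \<le> u \<and> v \<le> b \<and> u < v \<and> v - u < d \<and> t \<in> {u..v} \<and>
           \<bar>integral {u..v} f - (v - u) * f t\<bar> > inverse (Suc n) * (v - u))"
        unfolding bad_def mem_Collect_eq not_all not_imp not_ex by blast
      have good: "\<bar>integral {u..v} f - (v - u) * f t\<bar> \<le> inverse (Suc n) * (v - u)"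
        if "a \<le> u" "v \<le> b" "u < v" "v - u < d" "t \<in> {u..v}" for u v :: real
        using none[of u v] that by simp
      have split: "?F v - ?F u = integral {u..v} f" if "a \<le> u" "u \<le> v" "v \<le> b" for u v
        using Henstock_Kurzweil_Integration.integral_combine[where a=a and c=u and b=v and f=f] that integrable_subinterval_real[OF f, of a v] by auto
      define d' where "d' = min d (min (t - a) (b - t))"
      have "d' > 0" using d t by (auto simp: d'_def)
      moreover have "norm (?F y - ?F t - f t * (y - t)) \<le> e * norm (y - t)" if y: "norm (y - t) < d'" for y
      proof -
        have le: "inverse (Suc n) * \<bar>y - t\<bar> \<le> e * \<bar>y - t\<bar>"
          using n by (intro mult_right_mono) auto
        consider "y = t" | "t < y" | "y < t" by linarith
        then show ?thesis
        proof cases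
          case 2
          have "\<bar>integral {t..y} f - (y - t) * f t\<bar> \<le> inverse (Suc n) * (y - t)"
            using 2 y t by (intro good) (auto simp: d'_def)
          moreover have "?F y - ?F t = integral {t..y} f" using 2 y t by (intro split) (auto simp: d'_def)
          moreover have "f t * (y - t) = (y - t) * f t" by simp
          ultimately show ?thesis using le 2 unfolding real_norm_def by linarith
        next
          case 3
          have "\<bar>integral {y..t} f - (t - y) * f t\<bar> \<le> inverse (Suc n) * (t - y)"
            using 3 y t by (intro good) (auto simp: d'_def)
          moreover have "?F t - ?F y = integral {y..t} f" using 3 y t by (intro split) (auto simp: d'_def)
          moreover have "?F y - ?F t - f t * (y - t) = - ((?F t - ?F y) - (t - y) * f t)"
            by (simp add: algebra_simps)
          moreover have "\<bar>y - t\<bar> = t - y" using 3 by simp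
          ultimately show ?thesis using le unfolding real_norm_def by (metis abs_minus_cancel order_trans)
        qed simp
      qed
      ultimately show ?thesis by blast
    qed
    then show "(?F has_real_derivative f t) (at t)"
      unfolding has_field_derivative_def has_derivative_at_alt
      by (simp add: bounded_linear_mult_right)
  qed
qed


section \<open>The Riemann-Liouville kernel\<close>

text \<open>The kernel vanishes on the negative axis, so that convolution over the whole line with it is the
Riemann-Liouville integral with base point \<open>-\<infinity>\<close>.\<close>

definition rl_kernel :: "real \<Rightarrow> real \<Rightarrow> real" where
  "rl_kernel \<gamma> r = (if r > 0 then r powr (\<gamma> - 1) / Gamma \<gamma> else 0)"

lemma rl_kernel_measurable [measurable]: "rl_kernel \<gamma> \<in> borel_measurable borel"
  unfolding rl_kernel_def by measurable

lemma rl_kernel_nonneg [simp]: "\<gamma> > 0 \<Longrightarrow> 0 \<le> rl_kernel \<gamma> r"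
  by (simp add: rl_kernel_def Gamma_real_nonneg)

lemma rl_kernel_nonpos_arg: "r \<le> 0 \<Longrightarrow> rl_kernel \<gamma> r = 0"
  by (simp add: rl_kernel_def)

text \<open>Convolution with the kernel of order 1 is integration from \<open>-\<infinity>\<close>.\<close>

lemma rl_kernel_1: "rl_kernel 1 (M - s) = indicator {..<M} s"
  by (simp add: rl_kernel_def indicator_def)

lemma rl_kernel_mono: "1 \<le> \<gamma> \<Longrightarrow> r \<le> r' \<Longrightarrow> rl_kernel \<gamma> r \<le> rl_kernel \<gamma> r'"
  by (auto simp: rl_kernel_def Gamma_real_nonneg intro!: divide_right_mono powr_mono2)

text \<open>The substitution \<open>s = r + (t - r) x\<close> turns the convolution into the Beta integral. It is stated for
nonnegative integrals first because the interchange of integrals below needs Tonelli's theorem.\<close>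

lemma rl_kernel_convolution:
  assumes "\<gamma> > 0" "\<delta> > 0"
  shows "(\<integral>\<^sup>+s. rl_kernel \<gamma> (t - s) * rl_kernel \<delta> (s - r) \<partial>lborel) = rl_kernel (\<gamma> + \<delta>) (t - r)"
proof (cases "r < t")
  case False
  then have *: "rl_kernel \<gamma> (t - s) * rl_kernel \<delta> (s - r) = 0" for s
    by (simp add: rl_kernel_def)
  show ?thesis unfolding * using False by (simp add: rl_kernel_nonpos_arg)
next
  case True
  define c where "c = t - r"
  have c: "c > 0" using True by (simp add: c_def)
  have G: "Gamma \<gamma> > 0" "Gamma \<delta> > 0" "Gamma (\<gamma> + \<delta>) > 0" using assms by (auto intro: Gamma_real_pos)
  define q where "q = c powr (\<gamma> - 1) * c powr (\<delta> - 1) / (Gamma \<gamma> * Gamma \<delta>)"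
  have "q \<ge> 0" using c G by (simp add: q_def)
  have "Beta \<delta> \<gamma> \<ge> 0" using assms by (simp add: Beta_def Gamma_real_nonneg)
  have *: "rl_kernel \<gamma> (t - (r + c * x)) * rl_kernel \<delta> (r + c * x - r)
        = q * (indicator {0..1} x * (x powr (\<delta> - 1) * (1 - x) powr (\<gamma> - 1)))" for x
  proof -
    have t: "t - (r + c * x) = c * (1 - x)" by (simp add: c_def algebra_simps)
    consider "x \<le> 0" | "1 \<le> x" | "0 < x" "x < 1" by linarith
    then show ?thesis
    proof cases
      case 3
      then show ?thesis unfolding t
        using c by (simp add: rl_kernel_def powr_mult q_def)
    qed (use c in \<open>auto simp: t rl_kernel_def mult_le_0_iff zero_less_mult_iff indicator_def\<close>)
  qed
  have "(\<integral>\<^sup>+s. rl_kernel \<gamma> (t - s) * rl_kernel \<delta> (s - r) \<partial>lborel)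
      = c * (\<integral>\<^sup>+x. rl_kernel \<gamma> (t - (r + c * x)) * rl_kernel \<delta> (r + c * x - r) \<partial>lborel)"
    using c by (subst nn_integral_real_affine[where c=c and t=r]) auto
  also have "(\<integral>\<^sup>+x. rl_kernel \<gamma> (t - (r + c * x)) * rl_kernel \<delta> (r + c * x - r) \<partial>lborel)
      = q * (\<integral>\<^sup>+x. indicator {0..1} x * (x powr (\<delta> - 1) * (1 - x) powr (\<gamma> - 1)) \<partial>lborel)"
    unfolding * using \<open>q \<ge> 0\<close>
    by (subst nn_integral_cmult[symmetric]) (auto simp: ennreal_mult' intro!: nn_integral_cong)
  also have "(\<integral>\<^sup>+x. indicator {0..1} x * (x powr (\<delta> - 1) * (1 - x) powr (\<gamma> - 1)) \<partial>lborel) = Beta \<delta> \<gamma>"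
    using nn_integral_has_integral_lebesgue[OF _ has_integral_Beta_real[OF assms(2,1)]] by simp
  also have "ennreal c * (ennreal q * ennreal (Beta \<delta> \<gamma>)) = ennreal (c * (q * Beta \<delta> \<gamma>))"
    using c \<open>q \<ge> 0\<close> \<open>Beta \<delta> \<gamma> \<ge> 0\<close> by (simp add: ennreal_mult')
  also have "c * (q * Beta \<delta> \<gamma>) = rl_kernel (\<gamma> + \<delta>) (t - r)"
  proof -
    have "c * (c powr (\<gamma> - 1) * c powr (\<delta> - 1)) = c powr (\<gamma> + \<delta> - 1)"
      using c by (simp add: powr_add powr_diff)
    moreover have "c * (q * Beta \<delta> \<gamma>) = c * (c powr (\<gamma> - 1) * c powr (\<delta> - 1)) / Gamma (\<gamma> + \<delta>)"
      using G by (simp add: q_def Beta_def add.commute)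
    ultimately show ?thesis using c by (simp add: rl_kernel_def c_def)
  qed
  finally show ?thesis .
qed

lemma integral_rl_kernel_convolution:
  assumes "\<gamma> > 0" "\<delta> > 0"
  shows "(LINT s|lebesgue. rl_kernel \<gamma> (t - s) * rl_kernel \<delta> (s - r)) = rl_kernel (\<gamma> + \<delta>) (t - r)"
proof -
  have "(LINT s|lebesgue. rl_kernel \<gamma> (t - s) * rl_kernel \<delta> (s - r))
      = (LINT s|lborel. rl_kernel \<gamma> (t - s) * rl_kernel \<delta> (s - r))"
    by (intro integral_completion) measurable
  also have "\<dots> = rl_kernel (\<gamma> + \<delta>) (t - r)"
    using assms rl_kernel_convolution[OF assms]
    by (subst integral_eq_nn_integral) auto
  finally show ?thesis .
qed

interpretation lebesgue: sigma_finite_measure "lebesgue :: real measure"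
proof
  obtain A :: "real set set" where A: "countable A" "A \<subseteq> sets lborel" "\<Union>A = space lborel"
      "\<forall>a\<in>A. emeasure lborel a \<noteq> \<infinity>"
    using lborel.sigma_finite_countable by blast
  then show "\<exists>A::real set set. countable A \<and> A \<subseteq> sets lebesgue \<and> \<Union> A = space lebesgue \<and>
      (\<forall>a\<in>A. emeasure lebesgue a \<noteq> \<infinity>)"
    by (intro exI[of _ A]) auto
qed

interpretation lebesgue2: pair_sigma_finite "lebesgue :: real measure" "lebesgue :: real measure" ..


section \<open>Riemann-Liouville integrals\<close>

definition rl_integral :: "real \<Rightarrow> (real \<Rightarrow> real) \<Rightarrow> real \<Rightarrow> real" where
  "rl_integral \<gamma> f t = (LINT s|lebesgue. rl_kernel \<gamma> (t - s) * f s)"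

text \<open>The support condition makes the convolution with a kernel of any order an integral over a bounded
interval, and integrability up to every \<open>M\<close> is then the right notion of a locally integrable
function for it.\<close>

definition loc_integrable :: "real \<Rightarrow> (real \<Rightarrow> real) \<Rightarrow> bool" where
  "loc_integrable a f \<longleftrightarrow> f \<in> borel_measurable lebesgue \<and> (AE s in lebesgue. s < a \<longrightarrow> f s = 0) \<and>
     (\<forall>M. integrable lebesgue (\<lambda>s. indicator {..<M} s * f s))"

lemma loc_integrable_measurable [measurable_dest]: "loc_integrable a f \<Longrightarrow> f \<in> borel_measurable lebesgue"
  by (simp add: loc_integrable_def)

lemma loc_integrable_cong_AE:
  assumes "loc_integrable a f" and eq: "AE s in lebesgue. f s = g s"
  shows "loc_integrable a g"
  unfolding loc_integrable_def
proof (intro conjI allI)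
  show g: "g \<in> borel_measurable lebesgue"
    using assms borel_measurable_AE loc_integrable_measurable by blast
  show "AE s in lebesgue. s < a \<longrightarrow> g s = 0"
    using eq assms(1)[unfolded loc_integrable_def, THEN conjunct2, THEN conjunct1] by eventually_elim simp
  fix M
  have "integrable lebesgue (\<lambda>s. indicator {..<M} s * f s)"
    using assms(1) by (simp add: loc_integrable_def)
  then show "integrable lebesgue (\<lambda>s. indicator {..<M} s * g s)"
  proof (rule integrable_cong_AE_imp)
    note g[measurable]
    show "(\<lambda>s. indicator {..<M} s * g s) \<in> borel_measurable lebesgue"
      by (intro borel_measurable_times borel_measurable_indicator) auto
    show "AE s in lebesgue. indicator {..<M} s * f s = indicator {..<M} s * g s"
      using eq by eventually_elim simp
  qed
qed

lemma rl_integral_cong_AE: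
  assumes f: "f \<in> borel_measurable lebesgue" and eq: "AE s in lebesgue. f s = g s"
  shows "rl_integral \<gamma> f = rl_integral \<gamma> g"
proof
  fix t
  have [measurable]: "g \<in> borel_measurable lebesgue" by (rule borel_measurable_AE[OF assms])
  note f[measurable]
  have [measurable]: "(\<lambda>s. rl_kernel \<gamma> (t - s)) \<in> borel_measurable lebesgue"
    by (intro measurable_completion) measurable
  show "rl_integral \<gamma> f t = rl_integral \<gamma> g t"
    unfolding rl_integral_def by (rule integral_cong_AE) (use eq in \<open>auto elim!: eventually_mono\<close>)
qed

lemma rl_integral_cmult: "rl_integral \<gamma> (\<lambda>s. c * f s) t = c * rl_integral \<gamma> f t"
  unfolding rl_integral_def by (simp add: mult.left_commute)

lemma loc_integrable_cmult: "loc_integrable a f \<Longrightarrow> loc_integrable a (\<lambda>s. c * f s)"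
  by (auto simp: loc_integrable_def mult.left_commute[of _ c])

lemma loc_integrable_diff:
  assumes "loc_integrable a f" "loc_integrable a g"
  shows "loc_integrable a (\<lambda>s. f s - g s)"
  using assms unfolding loc_integrable_def by (auto simp: right_diff_distrib elim: eventually_elim2)

lemma measurable_fst_borel [measurable]:
  "fst \<in> borel_measurable ((lebesgue :: real measure) \<Otimes>\<^sub>M lebesgue)"
  by (rule measurable_compose[OF measurable_fst measurable_completion]) simp

lemma measurable_snd_borel [measurable]:
  "snd \<in> borel_measurable ((lebesgue :: real measure) \<Otimes>\<^sub>M lebesgue)"
  by (rule measurable_compose[OF measurable_snd measurable_completion]) simp

lemma rl_kernel_lebesgue_measurable [measurable]:
  "(\<lambda>s. rl_kernel \<gamma> (t - s)) \<in> borel_measurable lebesgue"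
  "(\<lambda>s. rl_kernel \<gamma> (s - t)) \<in> borel_measurable lebesgue"
  by (intro measurable_completion; measurable)+

lemma lessThan_lebesgue_measurable [measurable]: "{..<M::real} \<in> sets lebesgue"
  by simp

text \<open>From order 1 on, the kernel is bounded on bounded intervals; hence the integral converges at every
\<open>t\<close> and not only at almost every one.\<close>

lemma kernel_times_loc_integrable_integrable:
  assumes f: "loc_integrable a f" and "\<gamma> \<ge> 1"
  shows "integrable lebesgue (\<lambda>s. rl_kernel \<gamma> (t - s) * f s)"
proof (rule Bochner_Integration.integrable_bound)
  show "integrable lebesgue (\<lambda>s. rl_kernel \<gamma> (t - a) * (indicator {..<t} s * f s))"
    using f by (simp add: loc_integrable_def)
  note loc_integrable_measurable[OF f, measurable]
  show "(\<lambda>s. rl_kernel \<gamma> (t - s) * f s) \<in> borel_measurable lebesgue" by measurable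
  have "AE s in lebesgue. s < a \<longrightarrow> f s = 0" using f by (simp add: loc_integrable_def)
  then show "AE s in lebesgue. norm (rl_kernel \<gamma> (t - s) * f s)
      \<le> norm (rl_kernel \<gamma> (t - a) * (indicator {..<t} s * f s))"
  proof eventually_elim
    case (elim s)
    have "rl_kernel \<gamma> (t - s) \<le> rl_kernel \<gamma> (t - a)" if "a \<le> s"
      using that \<open>\<gamma> \<ge> 1\<close> by (intro rl_kernel_mono) auto
    then show ?case using elim \<open>\<gamma> \<ge> 1\<close>
      by (cases "s < a"; cases "s < t")
        (auto simp: abs_mult rl_kernel_nonpos_arg not_less intro!: mult_right_mono)
  qed
qed

text \<open>Tonelli's theorem reduces the claim to the convolution of the two kernels. This absolute version
yields integrability, the semi-group property and the \<open>L\<^sup>1\<close> bound alike.\<close>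

lemma nn_integral_kernel_semigroup:
  assumes [measurable]: "f \<in> borel_measurable lebesgue" and pos: "\<gamma> > 0" "\<delta> > 0"
  shows "(\<integral>\<^sup>+s. (\<integral>\<^sup>+r. \<bar>rl_kernel \<gamma> (t - s) * (rl_kernel \<delta> (s - r) * f r)\<bar> \<partial>lebesgue) \<partial>lebesgue)
       = (\<integral>\<^sup>+r. \<bar>rl_kernel (\<gamma> + \<delta>) (t - r) * f r\<bar> \<partial>lebesgue)" (is "?L = ?R")
proof -
  have "?L = (\<integral>\<^sup>+r. (\<integral>\<^sup>+s. \<bar>rl_kernel \<gamma> (t - s) * (rl_kernel \<delta> (s - r) * f r)\<bar> \<partial>lebesgue) \<partial>lebesgue)"
    by (rule lebesgue2.Fubini') measurable
  also have "\<dots> = ?R"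
  proof (rule nn_integral_cong)
    fix r
    have "(\<integral>\<^sup>+s. \<bar>rl_kernel \<gamma> (t - s) * (rl_kernel \<delta> (s - r) * f r)\<bar> \<partial>lebesgue)
        = (\<integral>\<^sup>+s. ennreal (rl_kernel \<gamma> (t - s) * rl_kernel \<delta> (s - r)) * ennreal \<bar>f r\<bar> \<partial>lebesgue)"
      using pos by (intro nn_integral_cong) (simp add: abs_mult ennreal_mult' mult.assoc)
    also have "\<dots> = (\<integral>\<^sup>+s. rl_kernel \<gamma> (t - s) * rl_kernel \<delta> (s - r) \<partial>lebesgue) * ennreal \<bar>f r\<bar>"
      by (intro nn_integral_multc) measurable
    also have "(\<integral>\<^sup>+s. rl_kernel \<gamma> (t - s) * rl_kernel \<delta> (s - r) \<partial>lebesgue) = rl_kernel (\<gamma> + \<delta>) (t - r)"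
      by (simp add: nn_integral_completion rl_kernel_convolution pos)
    finally show "(\<integral>\<^sup>+s. \<bar>rl_kernel \<gamma> (t - s) * (rl_kernel \<delta> (s - r) * f r)\<bar> \<partial>lebesgue)
        = ennreal \<bar>rl_kernel (\<gamma> + \<delta>) (t - r) * f r\<bar>"
      using pos by (simp add: abs_mult ennreal_mult')
  qed
  finally show ?thesis .
qed

lemma rl_integral_semigroup_pointwise:
  assumes [measurable]: "f \<in> borel_measurable lebesgue" and pos: "\<gamma> > 0" "\<delta> > 0"
    and int: "integrable lebesgue (\<lambda>r. rl_kernel (\<gamma> + \<delta>) (t - r) * f r)"
  shows "rl_integral \<gamma> (rl_integral \<delta> f) t = rl_integral (\<gamma> + \<delta>) f t"
proof -
  let ?g = "\<lambda>s r. rl_kernel \<gamma> (t - s) * (rl_kernel \<delta> (s - r) * f r)"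
  have "integrable (lebesgue \<Otimes>\<^sub>M lebesgue) (case_prod ?g)"
  proof (rule integrableI_bounded)
    have "(\<integral>\<^sup>+x. ennreal (norm (case_prod ?g x)) \<partial>(lebesgue \<Otimes>\<^sub>M lebesgue))
        = (\<integral>\<^sup>+s. (\<integral>\<^sup>+r. \<bar>?g s r\<bar> \<partial>lebesgue) \<partial>lebesgue)"
      by (subst lebesgue.nn_integral_fst[symmetric]) (auto simp: case_prod_unfold)
    also have "\<dots> < \<infinity>"
      using int unfolding nn_integral_kernel_semigroup[OF assms(1-3)] by (simp add: integrable_iff_bounded)
    finally show "(\<integral>\<^sup>+x. ennreal (norm (case_prod ?g x)) \<partial>(lebesgue \<Otimes>\<^sub>M lebesgue)) < \<infinity>" .
  qed measurable
  then have "(LINT r|lebesgue. LINT s|lebesgue. ?g s r) = (LINT s|lebesgue. LINT r|lebesgue. ?g s r)"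
    by (rule lebesgue2.Fubini_integral)
  moreover have "(LINT s|lebesgue. ?g s r) = rl_kernel (\<gamma> + \<delta>) (t - r) * f r" for r
    using integral_rl_kernel_convolution[OF pos, of t r] by (simp add: mult.assoc[symmetric])
  ultimately show ?thesis
    by (simp add: rl_integral_def)
qed

lemma rl_integral_semigroup:
  assumes "loc_integrable a f" "\<gamma> > 0" "\<delta> > 0" "\<gamma> + \<delta> \<ge> 1"
  shows "rl_integral \<gamma> (rl_integral \<delta> f) t = rl_integral (\<gamma> + \<delta>) f t"
  using assms by (intro rl_integral_semigroup_pointwise kernel_times_loc_integrable_integrable loc_integrable_measurable)

text \<open>The case \<open>\<gamma> = 1\<close>, where the outer integral runs over a half-line.\<close>

lemma nn_integral_kernel_loc_integrable:
  assumes f: "loc_integrable a f" and "\<delta> > 0"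
  shows "(\<integral>\<^sup>+s. indicator {..<M} s * (\<integral>\<^sup>+r. \<bar>rl_kernel \<delta> (s - r) * f r\<bar> \<partial>lebesgue) \<partial>lebesgue)
      = (\<integral>\<^sup>+r. \<bar>rl_kernel (1 + \<delta>) (M - r) * f r\<bar> \<partial>lebesgue)"
proof -
  note loc_integrable_measurable[OF f, measurable]
  have "(\<integral>\<^sup>+s. indicator {..<M} s * (\<integral>\<^sup>+r. \<bar>rl_kernel \<delta> (s - r) * f r\<bar> \<partial>lebesgue) \<partial>lebesgue)
    = (\<integral>\<^sup>+s. (\<integral>\<^sup>+r. \<bar>rl_kernel 1 (M - s) * (rl_kernel \<delta> (s - r) * f r)\<bar> \<partial>lebesgue) \<partial>lebesgue)"
  proof (rule nn_integral_cong)
    fix s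
    show "indicator {..<M} s * (\<integral>\<^sup>+r. \<bar>rl_kernel \<delta> (s - r) * f r\<bar> \<partial>lebesgue)
      = (\<integral>\<^sup>+r. \<bar>rl_kernel 1 (M - s) * (rl_kernel \<delta> (s - r) * f r)\<bar> \<partial>lebesgue)"
      unfolding rl_kernel_1 by (cases "s < M") auto
  qed
  then show ?thesis
    using nn_integral_kernel_semigroup[OF loc_integrable_measurable[OF f] _ \<open>\<delta> > 0\<close>, of 1 M] by simp
qed

lemma AE_below_natI:
  assumes "\<And>n::nat. AE s in lebesgue. s < real n \<longrightarrow> P s"
  shows "AE s in lebesgue. P s"
proof -
  have "AE s in lebesgue. \<forall>n::nat. s < real n \<longrightarrow> P s"
    using assms by (subst AE_all_countable) auto
  then show ?thesis
    by eventually_elim (use reals_Archimedean2 in blast)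
qed

text \<open>For orders below 1 the kernel is singular, but the integral of its absolute value is a locally
integrable function of \<open>t\<close> and so finite almost everywhere.\<close>

lemma AE_kernel_integrable:
  assumes f: "loc_integrable a f" and "\<delta> > 0"
  shows "AE t in lebesgue. integrable lebesgue (\<lambda>r. rl_kernel \<delta> (t - r) * f r)"
proof (rule AE_below_natI)
  fix n :: nat
  note loc_integrable_measurable[OF f, measurable]
  have "integrable lebesgue (\<lambda>r. rl_kernel (1 + \<delta>) (real n - r) * f r)"
    using f \<open>\<delta> > 0\<close> by (intro kernel_times_loc_integrable_integrable) auto
  then have "(\<integral>\<^sup>+s. indicator {..<real n} s * (\<integral>\<^sup>+r. \<bar>rl_kernel \<delta> (s - r) * f r\<bar> \<partial>lebesgue) \<partial>lebesgue) < \<infinity>"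
    unfolding nn_integral_kernel_loc_integrable[OF assms] by (simp add: integrable_iff_bounded)
  moreover have [measurable]: "(\<lambda>s. \<integral>\<^sup>+r. \<bar>rl_kernel \<delta> (s - r) * f r\<bar> \<partial>lebesgue) \<in> borel_measurable lebesgue"
    by (rule lebesgue.borel_measurable_nn_integral) measurable
  have "(\<lambda>s. indicator {..<real n} s * (\<integral>\<^sup>+r. \<bar>rl_kernel \<delta> (s - r) * f r\<bar> \<partial>lebesgue)) \<in> borel_measurable lebesgue"
    by measurable
  ultimately have "AE s in lebesgue. indicator {..<real n} s * (\<integral>\<^sup>+r. \<bar>rl_kernel \<delta> (s - r) * f r\<bar> \<partial>lebesgue) \<noteq> \<infinity>"
    by (intro nn_integral_PInf_AE) auto
  then show "AE t in lebesgue. t < real n \<longrightarrow> integrable lebesgue (\<lambda>r. rl_kernel \<delta> (t - r) * f r)"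
    by eventually_elim (auto simp: integrable_iff_bounded less_top)
qed

lemma rl_integral_semigroup_AE:
  assumes "loc_integrable a f" "\<gamma> > 0" "\<delta> > 0"
  shows "AE t in lebesgue. rl_integral \<gamma> (rl_integral \<delta> f) t = rl_integral (\<gamma> + \<delta>) f t"
proof -
  have "AE t in lebesgue. integrable lebesgue (\<lambda>r. rl_kernel (\<gamma> + \<delta>) (t - r) * f r)"
    using assms by (intro AE_kernel_integrable) auto
  then show ?thesis
    by eventually_elim (use assms in \<open>auto intro!: rl_integral_semigroup_pointwise loc_integrable_measurable\<close>)
qed

lemma rl_integral_eq_0:
  assumes "loc_integrable a f" "t \<le> a"
  shows "rl_integral \<gamma> f t = 0"
proof -
  have "AE s in lebesgue. s < a \<longrightarrow> f s = 0" using assms(1) by (simp add: loc_integrable_def)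
  then have "AE s in lebesgue. rl_kernel \<gamma> (t - s) * f s = 0"
    by eventually_elim (use assms(2) in \<open>auto simp: rl_kernel_def\<close>)
  then show ?thesis unfolding rl_integral_def by (rule integral_eq_zero_AE)
qed

text \<open>Fractional integration is bounded on \<open>L\<^sup>1\<close> of a bounded interval: by Tonelli's theorem the left-hand
side is at most the integral of order \<open>1 + \<delta>\<close> of \<open>\<bar>f\<bar>\<close> at \<open>M\<close>, whose kernel is bounded by its
value at \<open>M - a\<close>.\<close>

lemma rl_integral_L1_bound:
  assumes f: "loc_integrable a f" and "\<delta> > 0"
  shows "(\<integral>\<^sup>+s. \<bar>indicator {..<M} s * rl_integral \<delta> f s\<bar> \<partial>lebesgue)
      \<le> ennreal (rl_kernel (1 + \<delta>) (M - a)) * (\<integral>\<^sup>+s. \<bar>indicator {..<M} s * f s\<bar> \<partial>lebesgue)"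
proof -
  note loc_integrable_measurable[OF f, measurable]
  have "(\<integral>\<^sup>+s. \<bar>indicator {..<M} s * rl_integral \<delta> f s\<bar> \<partial>lebesgue)
      \<le> (\<integral>\<^sup>+s. indicator {..<M} s * (\<integral>\<^sup>+r. \<bar>rl_kernel \<delta> (s - r) * f r\<bar> \<partial>lebesgue) \<partial>lebesgue)"
  proof (rule nn_integral_mono)
    fix s
    have "ennreal \<bar>rl_integral \<delta> f s\<bar> \<le> (\<integral>\<^sup>+r. \<bar>rl_kernel \<delta> (s - r) * f r\<bar> \<partial>lebesgue)"
      using integral_norm_bound_ennreal[of lebesgue "\<lambda>r. rl_kernel \<delta> (s - r) * f r"]
      by (cases "integrable lebesgue (\<lambda>r. rl_kernel \<delta> (s - r) * f r)")
         (auto simp: rl_integral_def not_integrable_integral_eq)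
    then show "ennreal \<bar>indicator {..<M} s * rl_integral \<delta> f s\<bar>
        \<le> indicator {..<M} s * (\<integral>\<^sup>+r. \<bar>rl_kernel \<delta> (s - r) * f r\<bar> \<partial>lebesgue)"
      by (cases "s < M") auto
  qed
  also have "\<dots> = (\<integral>\<^sup>+r. \<bar>rl_kernel (1 + \<delta>) (M - r) * f r\<bar> \<partial>lebesgue)"
    by (rule nn_integral_kernel_loc_integrable[OF assms])
  also have "\<dots> \<le> (\<integral>\<^sup>+r. ennreal (rl_kernel (1 + \<delta>) (M - a)) * \<bar>indicator {..<M} r * f r\<bar> \<partial>lebesgue)"
  proof (rule nn_integral_mono_AE)
    have "AE s in lebesgue. s < a \<longrightarrow> f s = 0" using f by (simp add: loc_integrable_def)
    then show "AE r in lebesgue. ennreal \<bar>rl_kernel (1 + \<delta>) (M - r) * f r\<bar>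
        \<le> ennreal (rl_kernel (1 + \<delta>) (M - a)) * \<bar>indicator {..<M} r * f r\<bar>"
    proof eventually_elim
      case (elim r)
      have "rl_kernel (1 + \<delta>) (M - r) \<le> rl_kernel (1 + \<delta>) (M - a)" if "a \<le> r"
        using that \<open>\<delta> > 0\<close> by (intro rl_kernel_mono) auto
      then show ?case using elim \<open>\<delta> > 0\<close>
        by (cases "r < a"; cases "r < M")
          (auto simp: abs_mult rl_kernel_nonpos_arg not_less ennreal_mult'[symmetric] intro!: ennreal_leI mult_right_mono)
    qed
  qed
  also have "\<dots> = ennreal (rl_kernel (1 + \<delta>) (M - a)) * (\<integral>\<^sup>+s. \<bar>indicator {..<M} s * f s\<bar> \<partial>lebesgue)"
    by (intro nn_integral_cmult) measurable
  finally show ?thesis .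
qed

lemma rl_integral_measurable:
  assumes [measurable]: "f \<in> borel_measurable lebesgue"
  shows "rl_integral \<delta> f \<in> borel_measurable lebesgue"
  unfolding rl_integral_def[abs_def] by (rule lebesgue.borel_measurable_lebesgue_integral) measurable

lemma loc_integrable_rl_integral:
  assumes f: "loc_integrable a f" and "\<delta> > 0"
  shows "loc_integrable a (rl_integral \<delta> f)"
  unfolding loc_integrable_def
proof (intro conjI allI)
  note loc_integrable_measurable[OF f, measurable]
  show meas[measurable]: "rl_integral \<delta> f \<in> borel_measurable lebesgue"
    by (rule rl_integral_measurable) measurable
  show "AE s in lebesgue. s < a \<longrightarrow> rl_integral \<delta> f s = 0"
    using rl_integral_eq_0[OF f] by auto
  fix M
  have "integrable lebesgue (\<lambda>s. indicator {..<M} s * f s)" using f by (simp add: loc_integrable_def)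
  then have "(\<integral>\<^sup>+s. \<bar>indicator {..<M} s * f s\<bar> \<partial>lebesgue) < \<infinity>"
    by (simp add: integrable_iff_bounded)
  then have "(\<integral>\<^sup>+s. \<bar>indicator {..<M} s * rl_integral \<delta> f s\<bar> \<partial>lebesgue) < \<infinity>"
    by (intro le_less_trans[OF rl_integral_L1_bound[OF assms, of M]]) (simp add: ennreal_mult_less_top)
  moreover have "(\<lambda>s. indicator {..<M} s * rl_integral \<delta> f s) \<in> borel_measurable lebesgue"
    by (intro borel_measurable_times borel_measurable_indicator) auto
  ultimately show "integrable lebesgue (\<lambda>s. indicator {..<M} s * rl_integral \<delta> f s)"
    by (simp add: integrable_iff_bounded)
qed


section \<open>Fractional derivatives invert fractional integrals\<close>

lemma loc_integrable_mono: "loc_integrable a f \<Longrightarrow> a' \<le> a \<Longrightarrow> loc_integrable a' f"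
  unfolding loc_integrable_def by (auto elim!: eventually_mono)

lemma AE_lebesgue_neq: "AE s in lebesgue. s \<noteq> (c::real)"
  by (rule AE_completion) (rule AE_lborel_singleton)

lemma loc_integrable_restrict_AE:
  assumes "loc_integrable a f"
  shows "AE s in lebesgue. indicator {..<t} s * f s = indicator {a..t} s *\<^sub>R f s"
proof -
  have "AE s in lebesgue. s < a \<longrightarrow> f s = 0" using assms by (simp add: loc_integrable_def)
  with AE_lebesgue_neq[of t] show ?thesis
    by eventually_elim (auto simp: indicator_def)
qed

lemma loc_integrable_set_integrable:
  assumes "loc_integrable a f"
  shows "set_integrable lebesgue {a..t} f"
proof -
  note loc_integrable_measurable[OF assms, measurable]
  have "integrable lebesgue (\<lambda>s. indicator {..<t} s * f s)" using assms by (simp add: loc_integrable_def)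
  then show ?thesis
    unfolding set_integrable_def
    by (rule integrable_cong_AE_imp) (use loc_integrable_restrict_AE[OF assms] in \<open>auto intro!: borel_measurable_times borel_measurable_indicator\<close>)
qed

lemma rl_integral_1:
  assumes "loc_integrable a f"
  shows "rl_integral 1 f t = integral {a..t} f"
proof -
  note loc_integrable_measurable[OF assms, measurable]
  have "rl_integral 1 f t = (LINT s|lebesgue. indicator {a..t} s *\<^sub>R f s)"
    unfolding rl_integral_def rl_kernel_1
    by (rule integral_cong_AE) (use loc_integrable_restrict_AE[OF assms] in \<open>auto intro!: borel_measurable_times borel_measurable_indicator\<close>)
  also have "\<dots> = integral {a..t} f"
    using set_lebesgue_integral_eq_integral(2)[OF loc_integrable_set_integrable[OF assms]]
    by (simp add: set_lebesgue_integral_def)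
  finally show ?thesis .
qed

lemma loc_integrable_integrable_on: "loc_integrable a f \<Longrightarrow> f integrable_on {a..t}"
  using set_lebesgue_integral_eq_integral(1)[OF loc_integrable_set_integrable] .

lemma rl_integral_1_has_derivative_AE:
  assumes f: "loc_integrable a f"
  shows "AE t in lebesgue. (rl_integral 1 f has_real_derivative f t) (at t)"
proof (rule AE_below_natI)
  fix n :: nat
  have "AE s in lebesgue. s < a \<longrightarrow> f s = 0" using f by (simp add: loc_integrable_def)
  moreover note AE_lebesgue_neq[of a] Lebesgue_differentiation[OF loc_integrable_integrable_on[OF f, of n]]
  ultimately show "AE t in lebesgue. t < real n \<longrightarrow> (rl_integral 1 f has_real_derivative f t) (at t)"
  proof eventually_elim
    case (elim t)
    show ?case
    proof (cases "t < a")
      case True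
      have "((\<lambda>_. 0) has_real_derivative f t) (at t)" using elim True by simp
      then show ?thesis
        using rl_integral_eq_0[OF f] True
        by (auto intro: has_field_derivative_transform_within_open[where S="{..<a}"])
    next
      case False
      then show ?thesis using elim rl_integral_1[OF f]
        by (auto intro: has_field_derivative_transform_within_open[where S="{a<..<real n}"])
    qed
  qed
qed

text \<open>Moving the base point below \<open>t\<close> makes \<open>t\<close> an interior point.\<close>

lemma isCont_rl_integral_1:
  assumes "loc_integrable a f"
  shows "isCont (rl_integral 1 f) t"
proof -
  define a' where "a' = min a t - 1"
  have f: "loc_integrable a' f" using assms by (rule loc_integrable_mono) (simp add: a'_def)
  have "continuous_on {a'..t+1} (rl_integral 1 f)"
    unfolding rl_integral_1[OF f, abs_def] by (intro indefinite_integral_continuous_1 loc_integrable_integrable_on[OF f])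
  then show ?thesis
    by (rule continuous_on_interior) (auto simp: a'_def)
qed

lemma rl_integral_1_has_derivative:
  assumes "loc_integrable a f" and cont: "continuous_on UNIV f"
  shows "(rl_integral 1 f has_real_derivative f t) (at t)"
proof -
  define a' where "a' = min a t - 1"
  have f: "loc_integrable a' f" using assms(1) by (rule loc_integrable_mono) (simp add: a'_def)
  have "(rl_integral 1 f has_real_derivative f t) (at t within {a'..t+1})"
    unfolding rl_integral_1[OF f, abs_def]
    by (intro integral_has_real_derivative continuous_on_subset[OF cont]) (auto simp: a'_def)
  then show ?thesis
    by (subst (asm) at_within_Icc_at) (auto simp: a'_def)
qed

text \<open>From order 1 on, a fractional integral is an indefinite integral.\<close>

lemma continuous_rl_integral:
  assumes f: "loc_integrable a f" and "\<gamma> \<ge> 1"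
  shows "continuous_on UNIV (rl_integral \<gamma> f)"
proof (cases "\<gamma> = 1")
  case True
  then show ?thesis using isCont_rl_integral_1[OF f] by (simp add: continuous_at_imp_continuous_on)
next
  case False
  then have "rl_integral \<gamma> f = rl_integral 1 (rl_integral (\<gamma> - 1) f)"
    using rl_integral_semigroup[OF f, of 1 "\<gamma> - 1"] \<open>\<gamma> \<ge> 1\<close> by (auto simp: fun_eq_iff)
  moreover have "loc_integrable a (rl_integral (\<gamma> - 1) f)"
    using False \<open>\<gamma> \<ge> 1\<close> by (intro loc_integrable_rl_integral[OF f]) auto
  ultimately show ?thesis
    using isCont_rl_integral_1 by (auto intro: continuous_at_imp_continuous_on)
qed

lemma deriv_rl_integral:
  assumes f: "loc_integrable a f" and "\<gamma> \<ge> 1"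
  shows "deriv (rl_integral (\<gamma> + 1) f) = rl_integral \<gamma> f"
proof
  fix t
  have "rl_integral (\<gamma> + 1) f = rl_integral 1 (rl_integral \<gamma> f)"
    using rl_integral_semigroup[OF f, of 1 \<gamma>] \<open>\<gamma> \<ge> 1\<close> by (auto simp: fun_eq_iff add.commute)
  moreover have "(rl_integral 1 (rl_integral \<gamma> f) has_real_derivative rl_integral \<gamma> f t) (at t)"
    using assms by (intro rl_integral_1_has_derivative[OF loc_integrable_rl_integral[OF f]] continuous_rl_integral[OF f]) auto
  ultimately show "deriv (rl_integral (\<gamma> + 1) f) t = rl_integral \<gamma> f t"
    by (simp add: DERIV_imp_deriv)
qed

text \<open>All derivatives but the last exist everywhere, since each differentiates the indefinite integral of
a continuous function.\<close>

lemma deriv_iterate_rl_integral: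
  assumes f: "loc_integrable a f"
  shows "(deriv ^^ m) (rl_integral (real (Suc m)) f) = rl_integral 1 f"
proof (induction m)
  case (Suc m)
  have "(deriv ^^ Suc m) (rl_integral (real (Suc (Suc m))) f)
      = (deriv ^^ m) (deriv (rl_integral (real (Suc m) + 1) f))"
    by (simp add: funpow_Suc_right add.commute del: funpow.simps)
  also have "deriv (rl_integral (real (Suc m) + 1) f) = rl_integral (real (Suc m)) f"
    by (rule deriv_rl_integral[OF f]) simp
  finally show ?case using Suc.IH by simp
qed simp

lemma deriv_iterate_rl_integral_AE:
  assumes "loc_integrable a f" "n \<ge> 1"
  shows "AE t in lebesgue. (deriv ^^ n) (rl_integral (real n) f) t = f t"
proof -
  obtain m where n: "n = Suc m" using \<open>n \<ge> 1\<close> by (cases n) auto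
  have "(deriv ^^ n) (rl_integral (real n) f) = deriv (rl_integral 1 f)"
    using deriv_iterate_rl_integral[OF assms(1), of m] by (simp add: n)
  then show ?thesis
    using rl_integral_1_has_derivative_AE[OF assms(1)] by (auto elim!: eventually_mono intro: DERIV_imp_deriv)
qed

lemma frac_order_gt: "\<alpha> > 0 \<Longrightarrow> \<alpha> < real (frac_order \<alpha>)"
  unfolding frac_order_def by linarith

lemma frac_order_ge_1: "frac_order \<alpha> \<ge> 1"
  by (simp add: frac_order_def)

lemma left_frac_deriv_rl_integral:
  assumes "\<alpha> > 0"
  shows "left_frac_deriv \<alpha> f t = 1 / Gamma (real (frac_order \<alpha>) - \<alpha>) *
     (deriv ^^ frac_order \<alpha>) (\<lambda>\<tau>. Gamma (real (frac_order \<alpha>) - \<alpha>) * rl_integral (real (frac_order \<alpha>) - \<alpha>) f \<tau>) t"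
proof -
  define \<kappa> where "\<kappa> = real (frac_order \<alpha>) - \<alpha>"
  have "\<kappa> > 0" using frac_order_gt[OF \<open>\<alpha> > 0\<close>] by (simp add: \<kappa>_def)
  have "(LINT s:{..<\<tau>}|lebesgue. (\<tau> - s) powr (\<kappa> - 1) * f s) = Gamma \<kappa> * rl_integral \<kappa> f \<tau>" for \<tau>
  proof -
    have "(LINT s:{..<\<tau>}|lebesgue. (\<tau> - s) powr (\<kappa> - 1) * f s) = (LINT s|lebesgue. Gamma \<kappa> * (rl_kernel \<kappa> (\<tau> - s) * f s))"
      unfolding set_lebesgue_integral_def
      using Gamma_real_pos[OF \<open>\<kappa> > 0\<close>]
      by (intro Bochner_Integration.integral_cong) (auto simp: rl_kernel_def indicator_def)
    then show ?thesis by (simp add: rl_integral_def)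
  qed
  then show ?thesis by (simp add: left_frac_deriv_def Let_def \<kappa>_def)
qed

text \<open>Equality almost everywhere suffices in the hypothesis, because the derivative sees \<open>f\<close> only through an
integral. After \<open>J\<^sup>n\<^sup>-\<^sup>\<alpha> f = J\<^sup>n h\<close>, which holds at every point, \<open>n\<close> ordinary derivatives remain. The
factor \<open>\<Gamma>(n - \<alpha>)\<close>, which stands under the derivatives, is carried along inside \<open>h\<close>.\<close>

lemma left_frac_deriv_inverse_AE:
  assumes h: "loc_integrable a h" and "\<alpha> > 0" and f: "AE t in lebesgue. f t = rl_integral \<alpha> h t"
  shows "AE t in lebesgue. left_frac_deriv \<alpha> f t = h t"
proof -
  define n where "n = frac_order \<alpha>"
  define c where "c = Gamma (real n - \<alpha>)"
  have n: "\<alpha> < real n" "n \<ge> 1" using frac_order_gt frac_order_ge_1 \<open>\<alpha> > 0\<close> by (auto simp: n_def)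
  have "c > 0" using n by (simp add: c_def Gamma_real_pos)
  have "rl_integral \<alpha> h \<in> borel_measurable lebesgue"
    by (rule rl_integral_measurable[OF loc_integrable_measurable[OF h]])
  then have "rl_integral (real n - \<alpha>) f = rl_integral (real n - \<alpha>) (rl_integral \<alpha> h)"
    using f by (intro rl_integral_cong_AE[symmetric]) (auto elim: eventually_mono)
  then have "c * rl_integral (real n - \<alpha>) f \<tau> = rl_integral (real n) (\<lambda>s. c * h s) \<tau>" for \<tau>
    using rl_integral_semigroup[OF h, of "real n - \<alpha>" \<alpha> \<tau>] n \<open>\<alpha> > 0\<close> by (simp add: rl_integral_cmult)
  then have "left_frac_deriv \<alpha> f = (\<lambda>t. 1 / c * (deriv ^^ n) (rl_integral (real n) (\<lambda>s. c * h s)) t)"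
    using left_frac_deriv_rl_integral[OF \<open>\<alpha> > 0\<close>, of f] by (simp add: fun_eq_iff n_def c_def)
  then show ?thesis
    using deriv_iterate_rl_integral_AE[OF loc_integrable_cmult[OF h, of c] n(2)] \<open>c > 0\<close>
    by (auto elim!: eventually_mono)
qed


section \<open>Fractional derivatives of test functions\<close>

lemma test_function_derivative:
  assumes "\<phi> \<in> test_functions I"
  shows "((deriv ^^ k) \<phi> has_real_derivative (deriv ^^ Suc k) \<phi> t) (at t)"
  using assms by (auto simp: test_functions_def DERIV_deriv_iff_real_differentiable)

lemma test_function_continuous:
  assumes "\<phi> \<in> test_functions I"
  shows "continuous_on S ((deriv ^^ k) \<phi>)"
  using test_function_derivative[OF assms] by (meson DERIV_isCont continuous_at_imp_continuous_on)

lemma test_function_outside: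
  assumes "\<phi> \<in> test_functions I" "t \<notin> I"
  shows "(deriv ^^ k) \<phi> t = 0"
proof -
  obtain K where K: "compact K" "K \<subseteq> I" "\<And>t. t \<notin> K \<Longrightarrow> \<phi> t = 0"
    using assms(1) by (auto simp: test_functions_def)
  have "t \<in> - K \<Longrightarrow> (deriv ^^ k) \<phi> t = 0" for t
  proof (induction k arbitrary: t)
    case (Suc k)
    have "((\<lambda>_. 0) has_real_derivative 0) (at t)" by simp
    then have "((deriv ^^ k) \<phi> has_real_derivative 0) (at t)"
      by (rule has_field_derivative_transform_within_open[where S="- K"])
        (use Suc compact_imp_closed[OF K(1)] in auto)
    then show ?case by (simp add: DERIV_imp_deriv)
  qed (use K in auto)
  then show ?thesis using assms(2) K(2) by auto
qed

lemma test_function_bounded: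
  assumes "\<phi> \<in> test_functions {a<..<b}"
  obtains C where "C \<ge> 0" "\<And>t. \<bar>(deriv ^^ k) \<phi> t\<bar> \<le> C"
proof -
  have "bounded ((deriv ^^ k) \<phi> ` {a..b})"
    by (intro compact_imp_bounded compact_continuous_image test_function_continuous[OF assms]) auto
  then obtain C where C: "C > 0" "\<And>t. t \<in> {a..b} \<Longrightarrow> \<bar>(deriv ^^ k) \<phi> t\<bar> \<le> C"
    by (auto simp: bounded_pos)
  have "\<bar>(deriv ^^ k) \<phi> t\<bar> \<le> C" for t
    using C test_function_outside[OF assms, of t k] by (cases "t \<in> {a..b}") auto
  with C(1) show ?thesis by (intro that[of C]) auto
qed

lemma continuous_lebesgue_measurable:
  "continuous_on UNIV (f :: real \<Rightarrow> real) \<Longrightarrow> f \<in> borel_measurable lebesgue"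
  by (intro measurable_completion) (simp add: borel_measurable_continuous_onI)

lemma integrable_const_Icc: "integrable lebesgue (\<lambda>s. C * indicator {a..b::real} s :: real)"
  by (intro integrable_mult_right integrable_real_indicator) (auto simp: emeasure_lborel_Icc_eq)

lemma integrable_test_function:
  assumes \<phi>: "\<phi> \<in> test_functions {a<..<b}"
  shows "integrable lebesgue ((deriv ^^ k) \<phi>)"
proof -
  obtain C where C: "C \<ge> 0" "\<And>t. \<bar>(deriv ^^ k) \<phi> t\<bar> \<le> C"
    by (rule test_function_bounded[OF \<phi>, where k=k]) blast
  show ?thesis
  proof (rule Bochner_Integration.integrable_bound[OF integrable_const_Icc[of C a b]])
    show "(deriv ^^ k) \<phi> \<in> borel_measurable lebesgue"
      by (rule continuous_lebesgue_measurable[OF test_function_continuous[OF \<phi>]])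
    show "AE t in lebesgue. norm ((deriv ^^ k) \<phi> t) \<le> norm (C * indicator {a..b} t)"
      using C test_function_outside[OF \<phi>] by (auto simp: indicator_def)
  qed
qed

lemma loc_integrable_test_function:
  assumes \<phi>: "\<phi> \<in> test_functions {a<..<b}"
  shows "loc_integrable a ((deriv ^^ k) \<phi>)"
  unfolding loc_integrable_def
proof (intro conjI allI)
  show "(deriv ^^ k) \<phi> \<in> borel_measurable lebesgue"
    by (rule continuous_lebesgue_measurable[OF test_function_continuous[OF \<phi>]])
  show "AE t in lebesgue. t < a \<longrightarrow> (deriv ^^ k) \<phi> t = 0"
    using test_function_outside[OF \<phi>] by auto
  show "integrable lebesgue (\<lambda>s. indicator {..<M} s * (deriv ^^ k) \<phi> s)" for M
    using integrable_mult_indicator[OF _ integrable_test_function[OF \<phi>], of "{..<M}"] by simp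
qed

lemma test_function_rl_integral_1:
  assumes \<phi>: "\<phi> \<in> test_functions {a<..<b}"
  shows "rl_integral 1 ((deriv ^^ Suc k) \<phi>) = (deriv ^^ k) \<phi>"
proof
  fix t
  show "rl_integral 1 ((deriv ^^ Suc k) \<phi>) t = (deriv ^^ k) \<phi> t"
  proof (cases "t < a")
    case True
    then show ?thesis
      using rl_integral_eq_0[OF loc_integrable_test_function[OF \<phi>, of "Suc k"], of t 1]
        test_function_outside[OF \<phi>, of t k] by simp
  next
    case False
    have "((deriv ^^ Suc k) \<phi> has_integral ((deriv ^^ k) \<phi> t - (deriv ^^ k) \<phi> a)) {a..t}"
      using False test_function_derivative[OF \<phi>, of k]
      by (intro fundamental_theorem_of_calculus)
         (auto simp: has_real_derivative_iff_has_vector_derivative[symmetric]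
               intro: has_field_derivative_at_within)
    then show ?thesis
      using rl_integral_1[OF loc_integrable_test_function[OF \<phi>]] test_function_outside[OF \<phi>, of a k]
      by (metis diff_zero greaterThanLessThan_iff integral_unique less_irrefl)
  qed
qed

text \<open>Taylor's formula with integral remainder; the boundary terms vanish.\<close>

lemma test_function_rl_integral:
  assumes \<phi>: "\<phi> \<in> test_functions {a<..<b}" and "n \<ge> 1"
  shows "rl_integral (real n) ((deriv ^^ n) \<phi>) = \<phi>"
  using \<open>n \<ge> 1\<close>
proof (induction n rule: dec_induct)
  case base
  show ?case using test_function_rl_integral_1[OF \<phi>, of 0] by simp
next
  case (step m)
  have "rl_integral (real (Suc m)) ((deriv ^^ Suc m) \<phi>) = rl_integral (real m) (rl_integral 1 ((deriv ^^ Suc m) \<phi>))"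
    using rl_integral_semigroup[OF loc_integrable_test_function[OF \<phi>], of "real m" 1 "Suc m"] step
    by (simp add: fun_eq_iff add.commute)
  then show ?case using step test_function_rl_integral_1[OF \<phi>, of m] by simp
qed

lemma integral_test_function_derivative:
  assumes \<phi>: "\<phi> \<in> test_functions {a<..<b}"
  shows "(LINT t|lebesgue. (deriv ^^ Suc k) \<phi> t) = 0"
proof -
  have "(LINT t|lebesgue. (deriv ^^ Suc k) \<phi> t) = rl_integral 1 ((deriv ^^ Suc k) \<phi>) b"
    unfolding rl_integral_def rl_kernel_1
    by (intro Bochner_Integration.integral_cong) (use test_function_outside[OF \<phi>, of _ "Suc k"] in \<open>auto simp: indicator_def\<close>)
  also have "\<dots> = 0"
    using test_function_rl_integral_1[OF \<phi>, of k] test_function_outside[OF \<phi>, of b k] by simp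
  finally show ?thesis .
qed

text \<open>With \<open>q = y / x \<le> 1\<close> this is \<open>1 - q\<^sup>1\<^sup>-\<^sup>\<kappa> \<le> 1 - q\<close>, multiplied by \<open>y\<^sup>\<kappa>\<^sup>-\<^sup>1 \<le> 1\<close>.\<close>

lemma powr_difference_bound:
  fixes x y :: real
  assumes "1 \<le> y" "y \<le> x" "0 < \<kappa>" "\<kappa> \<le> 1"
  shows "\<bar>y powr (\<kappa> - 1) - x powr (\<kappa> - 1)\<bar> \<le> (x - y) / x"
proof -
  have "x powr (\<kappa> - 1) \<le> y powr (\<kappa> - 1)"
    using assms by (intro powr_mono2') auto
  have "y powr (\<kappa> - 1) \<le> 1" using assms powr_mono[of "\<kappa> - 1" 0 y] by simp
  have "y / x \<le> (y / x) powr (1 - \<kappa>)"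
    using assms powr_mono'[of "1 - \<kappa>" 1 "y / x"] by simp
  also have "\<dots> = x powr (\<kappa> - 1) / y powr (\<kappa> - 1)"
    using assms by (simp add: powr_divide powr_diff)
  finally have "y / x * y powr (\<kappa> - 1) \<le> x powr (\<kappa> - 1)"
    using assms by (simp add: field_simps)
  then have "y powr (\<kappa> - 1) - x powr (\<kappa> - 1) \<le> (1 - y / x) * y powr (\<kappa> - 1)"
    by (simp add: algebra_simps)
  also have "\<dots> \<le> (1 - y / x) * 1"
    using assms \<open>y powr (\<kappa> - 1) \<le> 1\<close> by (intro mult_left_mono) auto
  finally show ?thesis
    using \<open>x powr (\<kappa> - 1) \<le> y powr (\<kappa> - 1)\<close> assms by (simp add: diff_divide_distrib)
qed

text \<open>The kernel alone decays too slowly for square integrability when \<open>\<kappa> \<ge> 1/2\<close>. Because a derivative of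
a test function has integral zero, the constant \<open>rl_kernel \<kappa> (t - a)\<close> may be subtracted from the
kernel, and the difference is of order \<open>1 / (t - a)\<close>.\<close>

lemma rl_integral_test_function_decay:
  assumes \<phi>: "\<phi> \<in> test_functions {a<..<b}" and \<kappa>: "0 < \<kappa>" "\<kappa> \<le> 1" and "a < b"
  obtains D where "\<And>t. b + 1 \<le> t \<Longrightarrow> \<bar>rl_integral \<kappa> ((deriv ^^ Suc k) \<phi>) t\<bar> \<le> D / (t - a)"
proof -
  let ?\<psi> = "(deriv ^^ Suc k) \<phi>"
  obtain C where C: "C \<ge> 0" "\<And>t. \<bar>?\<psi> t\<bar> \<le> C"
    by (rule test_function_bounded[OF \<phi>, where k="Suc k"]) blast
  have G: "Gamma \<kappa> > 0" using \<kappa> by (simp add: Gamma_real_pos)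
  have int: "integrable lebesgue ?\<psi>" by (rule integrable_test_function[OF \<phi>])
  have "\<bar>rl_integral \<kappa> ?\<psi> t\<bar> \<le> ((b - a) * C / Gamma \<kappa> * (b - a)) / (t - a)" if t: "b + 1 \<le> t" for t
  proof -
    let ?g = "\<lambda>s. (rl_kernel \<kappa> (t - s) - rl_kernel \<kappa> (t - a)) * ?\<psi> s"
    let ?B = "(b - a) / (t - a) / Gamma \<kappa> * C"
    have bound: "\<bar>?g s\<bar> \<le> ?B * indicator {a..b} s" for s
    proof (cases "s \<in> {a<..<b}")
      case True
      have "\<bar>rl_kernel \<kappa> (t - s) - rl_kernel \<kappa> (t - a)\<bar>
          = \<bar>(t - s) powr (\<kappa> - 1) - (t - a) powr (\<kappa> - 1)\<bar> / Gamma \<kappa>"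
        using True t G by (simp add: rl_kernel_def diff_divide_distrib[symmetric])
      also have "\<dots> \<le> ((t - a) - (t - s)) / (t - a) / Gamma \<kappa>"
        using True t G \<kappa> by (intro divide_right_mono powr_difference_bound) auto
      also have "\<dots> \<le> (b - a) / (t - a) / Gamma \<kappa>"
        using True t G by (intro divide_right_mono) auto
      finally show ?thesis
        using True C(2)[of s] mult_mono[of "\<bar>rl_kernel \<kappa> (t - s) - rl_kernel \<kappa> (t - a)\<bar>"
            "(b - a) / (t - a) / Gamma \<kappa>" "\<bar>?\<psi> s\<bar>" C] t G \<open>a < b\<close>
        unfolding abs_mult by simp
    next
      case False
      then show ?thesis using test_function_outside[OF \<phi> False, of "Suc k"] t G C \<open>a < b\<close> by auto
    qed
    have g: "integrable lebesgue ?g"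
    proof (rule Bochner_Integration.integrable_bound[OF integrable_const_Icc[of ?B a b]])
      note borel_measurable_integrable[OF int, measurable]
      show "?g \<in> borel_measurable lebesgue" by measurable
      show "AE s in lebesgue. norm (?g s) \<le> norm (?B * indicator {a..b} s)"
        using bound by (intro AE_I2) (metis abs_ge_self order_trans real_norm_def)
    qed
    have "(LINT s|lebesgue. ?g s + rl_kernel \<kappa> (t - a) * ?\<psi> s) = (LINT s|lebesgue. ?g s) + rl_kernel \<kappa> (t - a) * (LINT s|lebesgue. ?\<psi> s)"
      using g int by (subst Bochner_Integration.integral_add) auto
    then have "rl_integral \<kappa> ?\<psi> t = (LINT s|lebesgue. ?g s)"
      unfolding integral_test_function_derivative[OF \<phi>] rl_integral_def by (simp add: left_diff_distrib)
    moreover have "\<bar>LINT s|lebesgue. ?g s\<bar> \<le> (LINT s|lebesgue. ?B * indicator {a..b} s)"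
      using bound by (intro integral_abs_bound_integral g integrable_const_Icc)
    moreover have "(LINT s|lebesgue. ?B * indicator {a..b} s) = ?B * (b - a)" using \<open>a < b\<close> by simp
    ultimately have "\<bar>rl_integral \<kappa> ?\<psi> t\<bar> \<le> ?B * (b - a)" by (simp only:)
    then show ?thesis by (simp add: mult_ac)
  qed
  then show ?thesis by (rule that)
qed

text \<open>A test function is dominated by a multiple of the kernel of order 1 based at \<open>a\<close>.\<close>

lemma rl_integral_test_function_bounded:
  assumes \<phi>: "\<phi> \<in> test_functions {a<..<b}" and \<kappa>: "0 < \<kappa>"
  obtains C where "\<And>t. t \<le> b + 1 \<Longrightarrow> \<bar>rl_integral \<kappa> ((deriv ^^ k) \<phi>) t\<bar> \<le> C"
proof -
  let ?\<psi> = "(deriv ^^ k) \<phi>"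
  obtain C where C: "C \<ge> 0" "\<And>t. \<bar>?\<psi> t\<bar> \<le> C"
    by (rule test_function_bounded[OF \<phi>, where k=k]) blast
  have "\<bar>rl_integral \<kappa> ?\<psi> t\<bar> \<le> C * rl_kernel (\<kappa> + 1) (b + 1 - a)" if t: "t \<le> b + 1" for t
  proof -
    let ?g = "\<lambda>s. C * (rl_kernel \<kappa> (t - s) * rl_kernel 1 (s - a))"
    have "(\<integral>\<^sup>+s. rl_kernel \<kappa> (t - s) * rl_kernel 1 (s - a) \<partial>lebesgue) = rl_kernel (\<kappa> + 1) (t - a)"
      by (simp add: nn_integral_completion rl_kernel_convolution \<kappa>)
    then have g: "integrable lebesgue ?g"
      using \<kappa> by (intro integrable_mult_right integrableI_nonneg) auto
    have bound: "\<bar>rl_kernel \<kappa> (t - s) * ?\<psi> s\<bar> \<le> ?g s" for s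
      using C(1) C(2)[of s] \<kappa> test_function_outside[OF \<phi>, of s k]
      by (cases "a < s") (auto simp: abs_mult rl_kernel_def[of 1] mult.commute[of C] intro!: mult_left_mono)
    have "integrable lebesgue (\<lambda>s. rl_kernel \<kappa> (t - s) * ?\<psi> s)"
    proof (rule Bochner_Integration.integrable_bound[OF g])
      note loc_integrable_measurable[OF loc_integrable_test_function[OF \<phi>], measurable]
      show "(\<lambda>s. rl_kernel \<kappa> (t - s) * ?\<psi> s) \<in> borel_measurable lebesgue" by measurable
      show "AE s in lebesgue. norm (rl_kernel \<kappa> (t - s) * ?\<psi> s) \<le> norm (?g s)"
        using bound by (intro AE_I2) (metis abs_ge_self order_trans real_norm_def)
    qed
    then have "\<bar>rl_integral \<kappa> ?\<psi> t\<bar> \<le> (LINT s|lebesgue. ?g s)"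
      unfolding rl_integral_def using g bound by (intro integral_abs_bound_integral) auto
    also have "\<dots> = C * rl_kernel (\<kappa> + 1) (t - a)"
      using integral_rl_kernel_convolution[OF \<kappa>, of 1 t a] by simp
    also have "\<dots> \<le> C * rl_kernel (\<kappa> + 1) (b + 1 - a)"
      using C(1) t \<kappa> by (intro mult_left_mono rl_kernel_mono) auto
    finally show ?thesis .
  qed
  then show ?thesis by (rule that)
qed

lemma square_integrable_decay:
  assumes [measurable]: "h \<in> borel_measurable lebesgue" and "a < c"
    and zero: "\<And>t. t \<le> a \<Longrightarrow> h t = 0"
    and C: "\<And>t. t \<le> c \<Longrightarrow> \<bar>h t\<bar> \<le> C" and D: "\<And>t. c \<le> t \<Longrightarrow> \<bar>h t\<bar> \<le> D / (t - a)"
  shows "square_integrable h"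
  unfolding square_integrable_def
proof (intro conjI)
  let ?q = "\<lambda>t. indicator {c - a..} t *\<^sub>R (t powr - 2) :: real"
  have "set_integrable lebesgue {c - a..} (\<lambda>t. t powr - 2 :: real)"
    using \<open>a < c\<close> by (intro nonnegative_absolutely_integrable_1 has_integral_integrable[OF has_integral_powr_to_inf]) auto
  then have "integrable lebesgue (\<lambda>t. ?q (- a + 1 * t))"
    unfolding set_integrable_def by (intro lebesgue_integrable_real_affine) auto
  then have int: "integrable lebesgue (\<lambda>t. C\<^sup>2 * indicator {a..c} t + D\<^sup>2 * ?q (- a + 1 * t))"
    by (intro Bochner_Integration.integrable_add integrable_const_Icc) auto
  show "integrable lebesgue (\<lambda>t. (h t)\<^sup>2)"
  proof (rule Bochner_Integration.integrable_bound[OF int])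
    have "(h t)\<^sup>2 \<le> C\<^sup>2 * indicator {a..c} t + D\<^sup>2 * ?q (- a + 1 * t)" for t
    proof -
      consider "t \<le> a" | "a < t" "t < c" | "c \<le> t" by linarith
      then show ?thesis
      proof cases
        case 2
        then show ?thesis using power_mono[OF C[of t], of 2] by simp
      next
        case 3
        then have "t - a > 0" using \<open>a < c\<close> by simp
        have "(h t)\<^sup>2 \<le> (D / (t - a))\<^sup>2" using power_mono[OF D[OF 3], of 2] by simp
        also have "\<dots> = D\<^sup>2 * (t - a) powr - 2"
          using \<open>t - a > 0\<close> by (simp add: powr_minus powr_numeral power_divide flip: divide_inverse)
        finally show ?thesis using 3 by (auto simp: indicator_def intro: add_increasing)
      qed (simp add: zero indicator_def)
    qed
    then show "AE t in lebesgue. norm ((h t)\<^sup>2) \<le> norm (C\<^sup>2 * indicator {a..c} t + D\<^sup>2 * ?q (- a + 1 * t))"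
      by (auto intro: order_trans)
  qed measurable
qed measurable

lemma square_integrable_cong_AE:
  assumes "square_integrable f" and eq: "AE t in lebesgue. f t = g t"
  shows "square_integrable g"
  unfolding square_integrable_def
proof
  show [measurable]: "g \<in> borel_measurable lebesgue"
    using assms borel_measurable_AE by (auto simp: square_integrable_def)
  have "integrable lebesgue (\<lambda>t. (f t)\<^sup>2)" using assms by (simp add: square_integrable_def)
  then show "integrable lebesgue (\<lambda>t. (g t)\<^sup>2)"
    by (rule integrable_cong_AE_imp) (use eq in \<open>auto elim: eventually_mono\<close>)
qed

lemma square_integrable_test_function:
  assumes \<phi>: "\<phi> \<in> test_functions {a<..<b}"
  shows "square_integrable \<phi>"
proof -
  obtain C where C: "C \<ge> 0" "\<And>t. \<bar>\<phi> t\<bar> \<le> C"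
    by (rule test_function_bounded[OF \<phi>, where k=0]) auto
  have [measurable]: "\<phi> \<in> borel_measurable lebesgue"
    using loc_integrable_measurable[OF loc_integrable_test_function[OF \<phi>, of 0]] by simp
  have "integrable lebesgue (\<lambda>t. (\<phi> t)\<^sup>2)"
  proof (rule Bochner_Integration.integrable_bound[OF integrable_const_Icc[of "C\<^sup>2" a b]])
    have "norm ((\<phi> t)\<^sup>2) \<le> norm (C\<^sup>2 * indicator {a..b} t)" for t
      using power_mono[OF C(2)[of t], of 2] test_function_outside[OF \<phi>, of t 0] by (auto simp: indicator_def)
    then show "AE t in lebesgue. norm ((\<phi> t)\<^sup>2) \<le> norm (C\<^sup>2 * indicator {a..b} t)" by simp
  qed measurable
  then show ?thesis by (simp add: square_integrable_def)
qed

text \<open>All three claims come from \<open>\<D>\<^sup>\<beta> \<phi> = J\<^sup>n\<^sup>-\<^sup>\<beta> \<phi>\<^sup>(\<^sup>n\<^sup>)\<close> almost everywhere. Here \<open>n\<close> is positive, so \<open>\<phi>\<^sup>(\<^sup>n\<^sup>)\<close> is the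
derivative of a test function and the decay estimate applies.\<close>

theorem left_frac_deriv_test_function:
  assumes \<phi>: "\<phi> \<in> test_functions {a<..<b}" and "a < b" and "\<beta> > 0"
  shows "loc_integrable a (left_frac_deriv \<beta> \<phi>)" "square_integrable (left_frac_deriv \<beta> \<phi>)"
    "rl_integral \<beta> (left_frac_deriv \<beta> \<phi>) = \<phi>"
proof -
  define n where "n = frac_order \<beta>"
  define h where "h = rl_integral (real n - \<beta>) ((deriv ^^ n) \<phi>)"
  have n: "\<beta> < real n" "n \<ge> 1" "real n - \<beta> \<le> 1"
    using \<open>\<beta> > 0\<close> unfolding n_def frac_order_def by linarith+
  obtain k where k: "n = Suc k" using n(2) by (cases n) auto
  have \<psi>: "loc_integrable a ((deriv ^^ n) \<phi>)" by (rule loc_integrable_test_function[OF \<phi>])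
  have h: "loc_integrable a h" unfolding h_def using n by (intro loc_integrable_rl_integral[OF \<psi>]) auto
  have "rl_integral \<beta> h = rl_integral (real n) ((deriv ^^ n) \<phi>)"
    using rl_integral_semigroup[OF \<psi>, of \<beta> "real n - \<beta>"] n \<open>\<beta> > 0\<close> by (auto simp: h_def fun_eq_iff)
  then have \<phi>h: "rl_integral \<beta> h = \<phi>" using test_function_rl_integral[OF \<phi> n(2)] by simp
  then have D: "AE t in lebesgue. h t = left_frac_deriv \<beta> \<phi> t"
    using left_frac_deriv_inverse_AE[OF h \<open>\<beta> > 0\<close>, of \<phi>] by (auto elim: eventually_mono)
  show "loc_integrable a (left_frac_deriv \<beta> \<phi>)" by (rule loc_integrable_cong_AE[OF h D])
  show "rl_integral \<beta> (left_frac_deriv \<beta> \<phi>) = \<phi>"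
    using rl_integral_cong_AE[OF loc_integrable_measurable[OF h] D, of \<beta>] \<phi>h by simp
  obtain C where C: "\<And>t. t \<le> b + 1 \<Longrightarrow> \<bar>h t\<bar> \<le> C"
    using rl_integral_test_function_bounded[OF \<phi>, of "real n - \<beta>" n] n unfolding h_def by auto
  obtain E where E: "\<And>t. b + 1 \<le> t \<Longrightarrow> \<bar>h t\<bar> \<le> E / (t - a)"
    using rl_integral_test_function_decay[OF \<phi>, of "real n - \<beta>" k] n \<open>a < b\<close> unfolding h_def k by auto
  have "square_integrable h"
    using rl_integral_eq_0[OF \<psi>] \<open>a < b\<close>
    by (intro square_integrable_decay[OF loc_integrable_measurable[OF h] _ _ C E]) (auto simp: h_def)
  then show "square_integrable (left_frac_deriv \<beta> \<phi>)" by (rule square_integrable_cong_AE[OF _ D])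
qed


section \<open>The closure of the test functions\<close>

lemma square_integrable_diff:
  assumes f: "square_integrable f" and g: "square_integrable g"
  shows "square_integrable (\<lambda>t. f t - g t)"
proof -
  have [measurable]: "f \<in> borel_measurable lebesgue" "g \<in> borel_measurable lebesgue"
    using assms by (auto simp: square_integrable_def)
  have int: "integrable lebesgue (\<lambda>t. 2 * (f t)\<^sup>2 + 2 * (g t)\<^sup>2)"
    using assms by (auto simp: square_integrable_def)
  have "(f t - g t)\<^sup>2 \<le> 2 * (f t)\<^sup>2 + 2 * (g t)\<^sup>2" for t
    using zero_le_power2[of "f t + g t"] by (simp add: power2_eq_square algebra_simps)
  then have "integrable lebesgue (\<lambda>t. (f t - g t)\<^sup>2)"
    by (intro Bochner_Integration.integrable_bound[OF int]) (auto intro: order_trans)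
  then show ?thesis by (simp add: square_integrable_def)
qed

lemma L2_norm_power2: "(L2_norm f)\<^sup>2 = (LINT t|lebesgue. (f t)\<^sup>2)"
  by (simp add: L2_norm_def)

text \<open>On \<open>{a..M}\<close> the inequality \<open>\<bar>x\<bar> \<le> \<epsilon> + x\<^sup>2 / \<epsilon>\<close> is integrated. With \<open>\<epsilon>\<close> of the size of the norm it
replaces the Cauchy-Schwarz inequality.\<close>

lemma nn_integral_L2_bound:
  assumes d: "square_integrable d" and zero: "AE t in lebesgue. t < a \<longrightarrow> d t = 0"
    and "\<epsilon> > 0" and "a \<le> M"
  shows "(\<integral>\<^sup>+t. \<bar>indicator {..<M} t * d t\<bar> \<partial>lebesgue)
      \<le> ennreal (\<epsilon> * (M - a) + (L2_norm d)\<^sup>2 / \<epsilon>)"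
proof -
  have int: "integrable lebesgue (\<lambda>t. \<epsilon> * indicator {a..M} t + (d t)\<^sup>2 / \<epsilon>)"
    using d by (intro Bochner_Integration.integrable_add integrable_const_Icc) (auto simp: square_integrable_def)
  have "(\<integral>\<^sup>+t. \<bar>indicator {..<M} t * d t\<bar> \<partial>lebesgue)
      \<le> (\<integral>\<^sup>+t. \<epsilon> * indicator {a..M} t + (d t)\<^sup>2 / \<epsilon> \<partial>lebesgue)"
    using zero
  proof (intro nn_integral_mono_AE, eventually_elim)
    case (elim t)
    have "\<bar>d t\<bar> \<le> \<epsilon> + (d t)\<^sup>2 / \<epsilon>"
    proof -
      have "0 \<le> \<epsilon> * \<bar>d t\<bar>" using \<open>\<epsilon> > 0\<close> by simp
      moreover have "2 * (\<epsilon> * \<bar>d t\<bar>) \<le> \<epsilon>\<^sup>2 + (d t)\<^sup>2"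
        using zero_le_power2[of "\<epsilon> - \<bar>d t\<bar>"] by (simp add: power2_diff)
      ultimately have "\<epsilon> * \<bar>d t\<bar> \<le> \<epsilon>\<^sup>2 + (d t)\<^sup>2" by linarith
      then show ?thesis using \<open>\<epsilon> > 0\<close> by (simp add: field_simps power2_eq_square)
    qed
    then have "\<bar>indicator {..<M} t * d t\<bar> \<le> \<epsilon> * indicator {a..M} t + (d t)\<^sup>2 / \<epsilon>"
      using elim \<open>\<epsilon> > 0\<close> by (auto simp: indicator_def)
    then show ?case by (rule ennreal_leI)
  qed
  also have "\<dots> = ennreal (LINT t|lebesgue. \<epsilon> * indicator {a..M} t + (d t)\<^sup>2 / \<epsilon>)"
    using \<open>\<epsilon> > 0\<close> by (intro nn_integral_eq_integral int) auto
  also have "(LINT t|lebesgue. \<epsilon> * indicator {a..M} t + (d t)\<^sup>2 / \<epsilon>) = \<epsilon> * (M - a) + (L2_norm d)\<^sup>2 / \<epsilon>"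
    unfolding L2_norm_power2 using d \<open>a \<le> M\<close>
    by (subst Bochner_Integration.integral_add) (auto simp: square_integrable_def integrable_const_Icc)
  finally show ?thesis .
qed

text \<open>On the half-line the difference to the approximations is \<open>h\<close> itself, so the integral of \<open>h\<^sup>2\<close> there is
below every squared distance.\<close>

lemma L2_limit_vanishing:
  assumes h: "square_integrable h" and hk: "\<And>k. square_integrable (h' k)"
    and zero: "\<And>k. AE t in lebesgue. t < a \<longrightarrow> h' k t = 0"
    and lim: "(\<lambda>k. L2_norm (\<lambda>t. h t - h' k t)) \<longlonglongrightarrow> 0"
  shows "AE t in lebesgue. t < a \<longrightarrow> h t = 0"
proof -
  have [measurable]: "h \<in> borel_measurable lebesgue" using h by (simp add: square_integrable_def)
  let ?I = "LINT t|lebesgue. indicator {..<a} t *\<^sub>R (h t)\<^sup>2"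
  have int: "integrable lebesgue (\<lambda>t. indicator {..<a} t *\<^sub>R (h t)\<^sup>2)"
    using h by (intro integrable_mult_indicator) (auto simp: square_integrable_def)
  have "?I \<le> (L2_norm (\<lambda>t. h t - h' k t))\<^sup>2" for k
    unfolding L2_norm_power2
  proof (rule integral_mono_AE[OF int])
    show "integrable lebesgue (\<lambda>t. (h t - h' k t)\<^sup>2)"
      using square_integrable_diff[OF h hk] by (simp add: square_integrable_def)
    show "AE t in lebesgue. indicator {..<a} t *\<^sub>R (h t)\<^sup>2 \<le> (h t - h' k t)\<^sup>2"
      using zero[of k] by eventually_elim (auto simp: indicator_def)
  qed
  then have "?I \<le> 0\<^sup>2" by (intro LIMSEQ_le_const[OF tendsto_power[OF lim]]) blast
  moreover have "?I \<ge> 0" by (intro integral_nonneg_AE) auto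
  ultimately have "?I = 0" by (simp del: real_scaleR_def)
  then have "AE t in lebesgue. indicator {..<a} t *\<^sub>R (h t)\<^sup>2 = 0"
    using integral_nonneg_eq_0_iff_AE[OF int] by simp
  then show ?thesis by eventually_elim (auto simp: indicator_def)
qed

lemma loc_integrable_square_integrable:
  assumes h: "square_integrable h" and zero: "AE t in lebesgue. t < a \<longrightarrow> h t = 0"
  shows "loc_integrable a h"
  unfolding loc_integrable_def
proof (intro conjI allI)
  show [measurable]: "h \<in> borel_measurable lebesgue" using h by (simp add: square_integrable_def)
  fix M
  have "(\<integral>\<^sup>+t. \<bar>indicator {..<M} t * h t\<bar> \<partial>lebesgue) \<le> (\<integral>\<^sup>+t. \<bar>indicator {..<max a M} t * h t\<bar> \<partial>lebesgue)"
    by (intro nn_integral_mono) (auto simp: indicator_def)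
  also have "\<dots> \<le> ennreal (1 * (max a M - a) + (L2_norm h)\<^sup>2 / 1)"
    by (rule nn_integral_L2_bound[OF h zero]) auto
  also have "\<dots> < \<infinity>" by simp
  finally show "integrable lebesgue (\<lambda>t. indicator {..<M} t * h t)"
    by (auto simp: integrable_iff_bounded)
qed (rule zero)

lemma L2_limit_L1:
  assumes h: "square_integrable h" and hk: "\<And>k. square_integrable (h' k)"
    and zero: "\<And>k. AE t in lebesgue. t < a \<longrightarrow> h' k t = 0"
    and lim: "(\<lambda>k. L2_norm (\<lambda>t. h t - h' k t)) \<longlonglongrightarrow> 0" and "a \<le> M"
  shows "(\<lambda>k. \<integral>\<^sup>+t. \<bar>indicator {..<M} t * (h t - h' k t)\<bar> \<partial>lebesgue) \<longlonglongrightarrow> 0"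
proof (rule tendsto_sandwich[where f = "\<lambda>_. 0"])
  let ?N = "\<lambda>k. L2_norm (\<lambda>t. h t - h' k t)"
  \<comment> \<open>The summand \<open>1 / (k + 1)\<close> keeps \<open>\<epsilon>\<close> positive when the distance is zero.\<close>
  let ?e = "\<lambda>k. ?N k + inverse (real (Suc k))"
  have N: "?N k \<ge> 0" for k by (simp add: L2_norm_def)
  have h0: "AE t in lebesgue. t < a \<longrightarrow> h t = 0" by (rule L2_limit_vanishing[OF h hk zero lim])
  show "\<forall>\<^sub>F k in sequentially. (\<integral>\<^sup>+t. \<bar>indicator {..<M} t * (h t - h' k t)\<bar> \<partial>lebesgue)
      \<le> ennreal (?e k * (M - a) + ?N k)"
  proof (intro always_eventually allI)
    fix k
    have e: "?e k > 0" using N[of k] by (simp add: add_nonneg_pos)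
    have "(?N k)\<^sup>2 \<le> ?N k * ?e k"
      using N[of k] unfolding power2_eq_square by (intro mult_left_mono) auto
    then have "(?N k)\<^sup>2 / ?e k \<le> ?N k" using e by (simp add: pos_divide_le_eq)
    moreover have "AE t in lebesgue. t < a \<longrightarrow> h t - h' k t = 0"
      using h0 zero[of k] by eventually_elim simp
    ultimately show "(\<integral>\<^sup>+t. \<bar>indicator {..<M} t * (h t - h' k t)\<bar> \<partial>lebesgue) \<le> ennreal (?e k * (M - a) + ?N k)"
      using e \<open>a \<le> M\<close>
      by (intro order_trans[OF nn_integral_L2_bound[OF square_integrable_diff[OF h hk], of a k "?e k" M]] ennreal_leI) auto
  qed
  have "(\<lambda>k. ?e k * (M - a) + ?N k) \<longlonglongrightarrow> (0 + 0) * (M - a) + 0"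
    by (intro tendsto_intros lim LIMSEQ_inverse_real_of_nat)
  then show "(\<lambda>k. ennreal (?e k * (M - a) + ?N k)) \<longlonglongrightarrow> 0"
    using tendsto_ennrealI by fastforce
qed auto

text \<open>The integral of a divergent integrand has the value 0, so additivity holds only where both integrals
converge.\<close>

lemma rl_integral_diff_AE:
  assumes f: "loc_integrable a f" and g: "loc_integrable a g" and "\<delta> > 0"
  shows "AE t in lebesgue. rl_integral \<delta> (\<lambda>s. f s - g s) t = rl_integral \<delta> f t - rl_integral \<delta> g t"
  using AE_kernel_integrable[OF f \<open>\<delta> > 0\<close>] AE_kernel_integrable[OF g \<open>\<delta> > 0\<close>]
  by eventually_elim (simp add: rl_integral_def right_diff_distrib)

lemma L2_norm_le_frac_dist:
  "L2_norm (\<lambda>t. f t - g t) \<le> frac_dist \<beta> f g"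
  "L2_norm (\<lambda>t. left_frac_deriv \<beta> f t - left_frac_deriv \<beta> g t) \<le> frac_dist \<beta> f g"
  unfolding frac_dist_def by (rule real_le_rsqrt, simp)+

text \<open>For the approximating test functions \<open>\<phi>\<^sub>k = J\<^sup>\<beta> (\<D>\<^sup>\<beta> \<phi>\<^sub>k)\<close>. Up to any \<open>M\<close>, the \<open>L\<^sup>1\<close> distance between \<open>f\<close> and
\<open>J\<^sup>\<beta> (\<D>\<^sup>\<beta> f)\<close> is therefore at most that between \<open>f\<close> and \<open>\<phi>\<^sub>k\<close> plus a multiple of that between
\<open>\<D>\<^sup>\<beta> f\<close> and \<open>\<D>\<^sup>\<beta> \<phi>\<^sub>k\<close>.\<close>

theorem frac_space_rl_integral:
  assumes f: "f \<in> frac_space \<beta> {a<..<b}" and "a < b" and "\<beta> > 0"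
  shows "loc_integrable a (left_frac_deriv \<beta> f)"
    and "AE t in lebesgue. f t = rl_integral \<beta> (left_frac_deriv \<beta> f) t"
proof -
  let ?D = "left_frac_deriv \<beta>"
  from f obtain \<phi> where \<phi>: "\<And>k::nat. \<phi> k \<in> test_functions {a<..<b}"
    and lim: "(\<lambda>k. frac_dist \<beta> f (\<phi> k)) \<longlonglongrightarrow> 0"
    and sq: "square_integrable f" "square_integrable (?D f)"
    by (auto simp: frac_space_def)
  note D\<phi> = left_frac_deriv_test_function[OF \<phi> \<open>a < b\<close> \<open>\<beta> > 0\<close>]
  have D\<phi>0: "AE t in lebesgue. t < a \<longrightarrow> ?D (\<phi> k) t = 0" for k
    using D\<phi>(1)[of k] by (simp add: loc_integrable_def)
  have \<phi>0: "AE t in lebesgue. t < a \<longrightarrow> \<phi> k t = 0" for k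
    using test_function_outside[OF \<phi>, of _ 0] by auto
  have lim1: "(\<lambda>k. L2_norm (\<lambda>t. f t - \<phi> k t)) \<longlonglongrightarrow> 0"
    and lim2: "(\<lambda>k. L2_norm (\<lambda>t. ?D f t - ?D (\<phi> k) t)) \<longlonglongrightarrow> 0"
    by (rule tendsto_sandwich[OF _ _ tendsto_const lim];
        use L2_norm_le_frac_dist in \<open>auto simp: L2_norm_def intro!: always_eventually\<close>)+
  note lims = L2_limit_L1[OF sq(1) square_integrable_test_function[OF \<phi>] \<phi>0 lim1]
    L2_limit_L1[OF sq(2) D\<phi>(2) D\<phi>0 lim2]
  have g: "loc_integrable a (?D f)"
    by (intro loc_integrable_square_integrable sq L2_limit_vanishing[OF sq(2) D\<phi>(2) D\<phi>0 lim2])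
  show "loc_integrable a (?D f)" by (rule g)
  have f0: "loc_integrable a f"
    by (intro loc_integrable_square_integrable sq L2_limit_vanishing[OF sq(1) square_integrable_test_function[OF \<phi>] \<phi>0 lim1])
  note [measurable] = loc_integrable_measurable[OF f0] rl_integral_measurable[OF loc_integrable_measurable[OF g], of \<beta>]
  show "AE t in lebesgue. f t = rl_integral \<beta> (?D f) t"
  proof (rule AE_below_natI)
    fix n :: nat
    define M where "M = max a (real n)"
    define K where "K = ennreal (rl_kernel (1 + \<beta>) (M - a))"
    let ?A = "\<lambda>k. \<integral>\<^sup>+t. \<bar>indicator {..<M} t * (f t - \<phi> k t)\<bar> \<partial>lebesgue"
    let ?B = "\<lambda>k. \<integral>\<^sup>+t. \<bar>indicator {..<M} t * (?D f t - ?D (\<phi> k) t)\<bar> \<partial>lebesgue"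
    let ?E = "\<integral>\<^sup>+t. \<bar>indicator {..<M} t * (f t - rl_integral \<beta> (?D f) t)\<bar> \<partial>lebesgue"
    have "?E \<le> ?A k + K * ?B k" for k
    proof -
      let ?d = "\<lambda>t. ?D f t - ?D (\<phi> k) t"
      have d: "loc_integrable a ?d" by (rule loc_integrable_diff[OF g D\<phi>(1)])
      note [measurable] = rl_integral_measurable[OF loc_integrable_measurable[OF d], of \<beta>]
        loc_integrable_measurable[OF loc_integrable_test_function[OF \<phi>, of 0 k], simplified]
      have "?E \<le> (\<integral>\<^sup>+t. ennreal \<bar>indicator {..<M} t * (f t - \<phi> k t)\<bar> + ennreal \<bar>indicator {..<M} t * rl_integral \<beta> ?d t\<bar> \<partial>lebesgue)"
        using rl_integral_diff_AE[OF g D\<phi>(1)[of k] \<open>\<beta> > 0\<close>]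
      proof (intro nn_integral_mono_AE, eventually_elim)
        case (elim t)
        then have "rl_integral \<beta> (?D f) t = \<phi> k t + rl_integral \<beta> ?d t" by (simp add: D\<phi>(3))
        then have "\<bar>indicator {..<M} t * (f t - rl_integral \<beta> (?D f) t)\<bar>
            \<le> \<bar>indicator {..<M} t * (f t - \<phi> k t)\<bar> + \<bar>indicator {..<M} t * rl_integral \<beta> ?d t\<bar>"
          by (auto simp: indicator_def)
        then show ?case by (simp add: ennreal_leI flip: ennreal_plus)
      qed
      also have "\<dots> = ?A k + (\<integral>\<^sup>+t. \<bar>indicator {..<M} t * rl_integral \<beta> ?d t\<bar> \<partial>lebesgue)"
        by (intro nn_integral_add) measurable
      also have "\<dots> \<le> ?A k + K * ?B k"
        unfolding K_def by (intro add_left_mono rl_integral_L1_bound[OF d \<open>\<beta> > 0\<close>])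
      finally show ?thesis .
    qed
    moreover have "(\<lambda>k. ?A k + K * ?B k) \<longlonglongrightarrow> 0 + K * 0"
      by (intro tendsto_add ennreal_tendsto_cmult lims) (auto simp: M_def K_def)
    ultimately have "?E \<le> 0" by (intro LIMSEQ_le_const) auto
    then have "?E = 0" by simp
    then have "AE t in lebesgue. ennreal \<bar>indicator {..<M} t * (f t - rl_integral \<beta> (?D f) t)\<bar> = 0"
      by (subst (asm) nn_integral_0_iff_AE) auto
    then show "AE t in lebesgue. t < real n \<longrightarrow> f t = rl_integral \<beta> (?D f) t"
      by eventually_elim (auto simp: indicator_def M_def)
  qed
qed

text \<open>With \<open>g = \<D>\<^sup>\<gamma>\<^sup>+\<^sup>\<delta> f\<close>, peeling off the factors of \<open>f = J\<^sup>\<delta> (J\<^sup>\<gamma> g)\<close> one at a time leaves \<open>c g\<close>. The constant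
\<open>c\<close> is part of the statement because \<^const>\<open>deriv\<close> has an arbitrary value at a point where no
derivative exists, which need not be compatible with scaling; it can be moved past the integral
\<open>J\<^sup>\<gamma>\<close> instead.\<close>

theorem left_frac_deriv_semigroup:
  assumes f: "f \<in> frac_space (\<gamma> + \<delta>) {a<..<b}" and "a < b" and "\<gamma> > 0" "\<delta> > 0"
  shows "AE t in lebesgue. left_frac_deriv \<gamma> (\<lambda>s. c * left_frac_deriv \<delta> f s) t
      = c * left_frac_deriv (\<gamma> + \<delta>) f t"
proof -
  define g where "g = left_frac_deriv (\<gamma> + \<delta>) f"
  have g: "loc_integrable a g" "AE t in lebesgue. f t = rl_integral (\<gamma> + \<delta>) g t"
    using frac_space_rl_integral[OF f \<open>a < b\<close>] \<open>\<gamma> > 0\<close> \<open>\<delta> > 0\<close> by (auto simp: g_def)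
  have "AE t in lebesgue. f t = rl_integral \<delta> (rl_integral \<gamma> g) t"
    using g(2) rl_integral_semigroup_AE[OF g(1) \<open>\<delta> > 0\<close> \<open>\<gamma> > 0\<close>]
    by eventually_elim (simp add: add.commute)
  then have "AE t in lebesgue. left_frac_deriv \<delta> f t = rl_integral \<gamma> g t"
    by (rule left_frac_deriv_inverse_AE[OF loc_integrable_rl_integral[OF g(1) \<open>\<gamma> > 0\<close>] \<open>\<delta> > 0\<close>])
  then have "AE t in lebesgue. c * left_frac_deriv \<delta> f t = rl_integral \<gamma> (\<lambda>s. c * g s) t"
    by eventually_elim (simp add: rl_integral_cmult)
  then show ?thesis
    unfolding g_def[symmetric]
    by (rule left_frac_deriv_inverse_AE[OF loc_integrable_cmult[OF g(1)] \<open>\<gamma> > 0\<close>])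
qed


section \<open>The embedded Euler-Lagrange equation of the wave density\<close>

lemma deriv_half_square: "deriv (\<lambda>v. c / 2 * v\<^sup>2 - d) v = c * (v::real)"
  by (rule DERIV_imp_deriv) (auto intro!: derivative_eq_intros)

lemma deriv_neg_half_square: "deriv (\<lambda>w. d - c / 2 * w\<^sup>2) w = - c * (w::real)"
  by (rule DERIV_imp_deriv) (auto intro!: derivative_eq_intros)

text \<open>The inner partial derivatives are \<open>0\<close>, \<open>\<rho> v\<close> and \<open>- T w\<close>; the minus sign moves the last term to the other
side.\<close>

lemma wave_euler_lagrange:
  assumes "deriv (\<lambda>\<xi>. u t \<xi>) differentiable (at x)"
  shows "euler_lagrange_with D (wave_density \<rho> T) u t x \<longleftrightarrow>
    D (\<lambda>s. \<rho> * D (\<lambda>r. u r x) s) t = T * (deriv ^^ 2) (\<lambda>\<xi>. u t \<xi>) x"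
proof -
  have "(deriv (\<lambda>\<xi>. u t \<xi>) has_real_derivative deriv (deriv (\<lambda>\<xi>. u t \<xi>)) x) (at x)"
    using assms by (simp add: DERIV_deriv_iff_real_differentiable)
  then have "deriv (\<lambda>\<xi>. - T * deriv (\<lambda>\<xi>. u t \<xi>) \<xi>) x = - T * (deriv ^^ 2) (\<lambda>\<xi>. u t \<xi>) x"
    by (intro DERIV_imp_deriv) (auto intro!: derivative_eq_intros simp: eval_nat_numeral)
  then show ?thesis
    unfolding euler_lagrange_with_def Let_def wave_density_def deriv_half_square deriv_neg_half_square
    by (auto simp: deriv_const)
qed

theorem corollary8p1:
  fixes \<alpha> \<rho> T a b :: real and X :: "real set" and u :: "real \<Rightarrow> real \<Rightarrow> real"
  assumes "\<alpha> > 0"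
    and "a < b"
    and "open X"
    and "\<And>x. x \<in> X \<Longrightarrow> (\<lambda>t. u t x) \<in> frac_space (2 * \<alpha>) {a<..<b}"
    and "\<And>t x. x \<in> X \<Longrightarrow> (\<lambda>\<xi>. u t \<xi>) differentiable (at x)"
    and "\<And>t x. x \<in> X \<Longrightarrow> deriv (\<lambda>\<xi>. u t \<xi>) differentiable (at x)"
  shows "\<forall>x\<in>X. AE t in lebesgue.
           frac_embedded_euler_lagrange \<alpha> (wave_density \<rho> T) u t x \<longleftrightarrow>
           frac_wave_equation \<alpha> \<rho> T u t x"
proof
  fix x assume x: "x \<in> X"
  have "AE t in lebesgue. left_frac_deriv \<alpha> (\<lambda>s. \<rho> * left_frac_deriv \<alpha> (\<lambda>r. u r x) s) t
      = \<rho> * left_frac_deriv (2 * \<alpha>) (\<lambda>s. u s x) t"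
    unfolding mult_2
    by (rule left_frac_deriv_semigroup[OF assms(4)[OF x, unfolded mult_2] \<open>a < b\<close> \<open>\<alpha> > 0\<close> \<open>\<alpha> > 0\<close>])
  then show "AE t in lebesgue. frac_embedded_euler_lagrange \<alpha> (wave_density \<rho> T) u t x \<longleftrightarrow>
      frac_wave_equation \<alpha> \<rho> T u t x"
    by eventually_elim (simp add: wave_euler_lagrange[OF assms(6)[OF x]] frac_wave_equation_def)
qed

end
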